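(* Let $p\in(1,\infty)$ with $p\neq 2$. Then there exists an infinite sequence $\varpi_1,\varpi_2,\varpi_3,\dots,\varpi_m,\dots$ of positive numbers, depending on $p$, such that $$\frac{\varpi_m}{\varpi_{m'}}\notin\mathbb{N}\quad\text{whenever } m\neq m',$$ and, for every $m\in\mathbb{N}$, $\varpi_m$ yields a sequence of $1$-periodic eigenvalues $$\Lambda_m:=\{\lambda_{m,n}:=(2n\varpi_m)^p : n\in\mathbb{N}\}\subset\Sigma_{p,2}^*.$$
   Context: $\mathbb{N}$ is the set of positive integers and $\|\cdot\|$ is the Euclidean norm on $\mathbb{R}^2$. For $p\in(1,\infty)$ let $\phi_p:\mathbb{R}^2\to\mathbb{R}^2$, $\phi_p(\mathbf{x})=\|\mathbf{x}\|^{p-2}\mathbf{x}$ (with $\phi_p(\mathbf 0)=\mathbf 0$). A real number $\lambda$ is a ($1$-periodic) eigenvalue of the vectorial $p$-Laplacian on the plane if there is a solution $\mathbf{x}(t)\not\equiv\mathbf{0}$, $\mathbf{x}:\mathbb{R}\to\mathbb{R}^2$, of $$(\phi_p(\dot{\mathbf{x}}))^{\cdot}+\lambda\,\phi_p(\mathbf{x})=\mathbf{0}$$ satisfying $(\mathbf{x}(1),\dot{\mathbf{x}}(1))=(\mathbf{x}(0),\dot{\mathbf{x}}(0))$. A solution means that $\mathbf{x}$ and $\phi_p(\dot{\mathbf{x}})$ are $C^1$ and the equation holds. $\Sigma_{p,2}$ denotes the set of all real eigenvalues and $\Sigma_{p,2}^*:=\Sigma_{p,2}\setminus\{0\}$.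 *)

theory Defs
  imports "HOL-Analysis.Analysis"
begin

text \<open>For every \<^term>\<open>p\<close>, \<^term>\<open>phi p 0 = 0\<close> is automatic because the vector factor vanishes;
  this is the convention needed for \<^term>\<open>p < 2\<close>.\<close>

definition phi :: "real \<Rightarrow> real ^ 2 \<Rightarrow> real ^ 2" where
  "phi p x = (norm x powr (p - 2)) *\<^sub>R x"

definition p_laplacian_solution :: "real \<Rightarrow> real \<Rightarrow> (real \<Rightarrow> real ^ 2) \<Rightarrow> bool" where
  "p_laplacian_solution p l x \<longleftrightarrow>
     x C1_differentiable_on UNIV \<and>
     (\<lambda>t. phi p (vector_derivative x (at t))) C1_differentiable_on UNIV \<and>
     (\<forall>t. vector_derivative (\<lambda>s. phi p (vector_derivative x (at s))) (at t)
            + l *\<^sub>R phi p (x t) = 0)"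

definition periodic_eigenvalue :: "real \<Rightarrow> real \<Rightarrow> bool" where
  "periodic_eigenvalue p l \<longleftrightarrow>
     (\<exists>x. p_laplacian_solution p l x \<and> (\<exists>t. x t \<noteq> 0) \<and>
          x 1 = x 0 \<and> vector_derivative x (at 1) = vector_derivative x (at 0))"

definition Sigma_star :: "real \<Rightarrow> real set" where
  "Sigma_star p = {l. periodic_eigenvalue p l} - {0}"

end

theory Submission
  imports Defs
begin

text \<open>
  Let \<open>q\<close> be the exponent conjugate to \<open>p\<close> and put \<open>y = phi p x'\<close>. For \<open>\<lambda> = 1\<close> the equation is the
  Hamiltonian system \<open>x' = |y|^(q-2) y\<close>, \<open>y' = - |x|^(p-2) x\<close> with energy \<open>|x|^p/p + |y|^q/q\<close> and
  angular momentum \<open>s = x \<times> y\<close>. If one of its solutions has period \<open>t\<close>, running it \<open>n t\<close> times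
  faster shows that \<open>(n t)^p\<close> is an eigenvalue, so infinitely many periods are needed, none of which
  is an integer multiple of another one.

  On the energy level one, \<open>a = |x|^p\<close> determines \<open>b = |y|^q\<close>, and with \<open>W = x \<bullet> y\<close> one has
  \<open>W^2 + s^2 = a^(2/p) b^(2/q)\<close> and \<open>W' = b - a\<close>. The right-hand side of the first identity is at most one,
  with equality only at \<open>a = 1\<close>; writing it as \<open>1 - v^2\<close>, where \<open>v\<close> has the sign of \<open>a - 1\<close>, turns the
  level curves of \<open>s\<close> into circles \<open>(v, W) = r (sin \<phi>, cos \<phi>)\<close>, \<open>r^2 = 1 - s^2\<close>. In the variable
  \<open>\<phi>\<close> nothing is singular: \<open>dt/d\<phi> = h v\<close> for a positive continuous function \<open>h\<close> on \<open>[-1,1]\<close>. Hence a radial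
  oscillation takes the time \<open>T r = \<integral> h (r sin \<phi>) d\<phi>\<close> (integrated over a full circle), and during it
  the orbit turns by the angle \<open>\<Theta> r = s \<integral> h v / (1 - v^2) d\<phi>\<close> with \<open>v = r sin \<phi>\<close>. Here \<open>T\<close> is
  \<open>circle_int h\<close> and \<open>\<Theta>\<close> is \<open>turn h\<close>. If \<open>l \<Theta> r = 2 \<pi> k\<close>, the orbit closes up with
  period \<open>l T r\<close> (\<open>orbit_exists\<close>).

  Two facts about \<open>T\<close> and \<open>\<Theta>\<close> carry the proof. First, \<open>\<Theta>\<close> is not constant if \<open>p \<noteq> 2\<close>: it is
  \<open>2 \<pi> / sqrt (p q)\<close>, which is less than \<open>\<pi>\<close>, for the circular orbit \<open>r = 0\<close>, and it tends to
  \<open>\<pi> (1/p + 1/q) = \<pi>\<close> as \<open>r\<close> tends to one (\<open>exists_turn_gt\<close>). Second, \<open>dT = s d\<Theta>\<close>, the usual relation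
  between period and rotation; it takes here the derivative-free form that \<open>T r1 \<le> T r2\<close> if \<open>\<Theta>\<close> does
  not drop below \<open>\<Theta> r1\<close> on \<open>[r1, r2]\<close> (\<open>circle_int_le_of_turn_ge\<close>).

  So choose a rational \<open>k/l\<close> strictly between \<open>\<Theta> 0 / 2\<pi>\<close> and \<open>\<Theta> R / 2\<pi>\<close>, and let \<open>r\<^sub>m\<close> be the last
  point before \<open>R\<close> at which \<open>\<Theta>/2\<pi>\<close> takes the value \<open>(k m - 1) / (l m)\<close>. These values increase, so
  \<open>T r\<^sub>m\<close> increases weakly, and the periods \<open>t\<^sub>m = l m T r\<^sub>m\<close> increase strictly but at most linearly.
  The multiples of a large number \<open>t\<^sub>i\<close> have small density among the \<open>t\<^sub>m\<close>; a greedy choice therefore yields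
  an infinite subsequence without integer ratios (\<open>infinite_nondividing_subsequence\<close>).
\<close>

section \<open>Subsequences without integer ratios\<close>

text \<open>The quotients \<open>t j / c\<close> are distinct positive integers bounded by \<open>b / c\<close>.\<close>

lemma card_multiples_le:
  fixes t :: "nat \<Rightarrow> real"
  assumes t: "strict_mono t" and c: "0 < c" and ub: "\<And>j. j < n \<Longrightarrow> t j \<le> b"
    and b: "0 \<le> b"
  shows "real (card {j. j < n \<and> t j / c \<in> {real k | k. 1 \<le> k}}) \<le> b / c"
proof -
  define M where "M = {j. j < n \<and> t j / c \<in> {real k | k. 1 \<le> k}}"
  have "\<exists>k. 1 \<le> k \<and> t j = real k * c" if "j \<in> M" for j
    using that c by (force simp: M_def field_simps)
  then obtain g where g: "\<And>j. j \<in> M \<Longrightarrow> 1 \<le> g j \<and> t j = real (g j) * c"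
    by metis
  have "inj_on g M"
    by (rule inj_onI) (metis g strict_mono_eq[OF t])
  moreover have "g ` M \<subseteq> {1..nat \<lfloor>b / c\<rfloor>}"
  proof
    fix k assume "k \<in> g ` M"
    then obtain j where j: "j \<in> M" "k = g j" by auto
    then have "real k * c \<le> b" using g[of j] ub[of j] by (auto simp: M_def)
    then have "real k \<le> b / c" using c by (simp add: field_simps)
    then show "k \<in> {1..nat \<lfloor>b / c\<rfloor>}" using g[of j] j by (auto simp: le_nat_floor)
  qed
  ultimately have "card M \<le> card {1..nat \<lfloor>b / c\<rfloor>}"
    by (intro card_inj_on_le) auto
  then have "real (card M) \<le> real (nat \<lfloor>b / c\<rfloor>)" by simp
  also have "\<dots> \<le> b / c" using b c by (simp add: of_nat_floor)
  finally show ?thesis by (simp add: M_def)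
qed

text \<open>A density argument: among the first \<open>n\<close> indices at most \<open>C n / t i\<close> belong to multiples of \<open>t i\<close>. By
the hypothesis on \<open>S\<close> the multiples altogether occupy a proportion of the indices bounded away from one.\<close>

lemma exists_nonmultiple:
  fixes t :: "nat \<Rightarrow> real"
  assumes t: "strict_mono t" and pos: "\<And>n. 0 < t n" and C: "\<And>n. t n \<le> C * real (Suc n)"
    and S: "finite S" "(\<Sum>i\<in>S. C / t i) < 1"
  shows "\<exists>j\<ge>N. \<forall>i\<in>S. t j / t i \<notin> {real k | k. 1 \<le> k}"
proof (rule ccontr)
  assume "\<not> ?thesis"
  then have bad: "\<exists>i\<in>S. t j / t i \<in> {real k | k. 1 \<le> k}" if "j \<ge> N" for j
    using that by blast
  define D where "D = (\<lambda>n i. {j. j < n \<and> t j / t i \<in> {real k | k. 1 \<le> k}})"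
  define \<sigma> where "\<sigma> = (\<Sum>i\<in>S. C / t i)"
  have C0: "0 < C" using pos[of 0] C[of 0] by simp
  have "real n - real N \<le> \<sigma> * real n" for n
  proof -
    have "{N..<n} \<subseteq> (\<Union>i\<in>S. D n i)" using bad by (fastforce simp: D_def)
    then have "card {N..<n} \<le> card (\<Union>i\<in>S. D n i)"
      by (intro card_mono) (auto simp: S D_def)
    also have "\<dots> \<le> (\<Sum>i\<in>S. card (D n i))" by (rule card_UN_le[OF S(1)])
    finally have "real (card {N..<n}) \<le> (\<Sum>i\<in>S. real (card (D n i)))"
      by (metis of_nat_mono of_nat_sum)
    also have "\<dots> \<le> (\<Sum>i\<in>S. (C * real n) / t i)"
    proof (rule sum_mono)
      fix i assume "i \<in> S"
      have "t j \<le> C * real n" if "j < n" for j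
        using C[of j] that C0 by (smt (verit) mult_left_mono of_nat_mono Suc_leI)
      then show "real (card (D n i)) \<le> (C * real n) / t i"
        unfolding D_def using C0 by (intro card_multiples_le[OF t pos]) auto
    qed
    also have "\<dots> = \<sigma> * real n" by (simp add: \<sigma>_def sum_distrib_right)
    finally show ?thesis by simp
  qed
  then have "(1 - \<sigma>) * real n \<le> real N" for n by (simp add: algebra_simps)
  moreover obtain n where "real N / (1 - \<sigma>) < real n" using reals_Archimedean2 by blast
  ultimately show False using S(2) by (fold \<sigma>_def) (smt (verit) pos_divide_less_eq mult.commute)
qed

text \<open>The greedy choice keeps a finite set \<open>S\<close> of indices with \<open>(\<Sum>i\<in>S. C / t i) < 1\<close>. As \<open>t\<close> is unbounded, a new
index can be taken so large that this inequality survives, and the density argument makes its term a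
multiple of none of the earlier ones. In the other order a ratio is less than one.\<close>

lemma infinite_nondividing_subsequence:
  fixes t :: "nat \<Rightarrow> real"
  assumes t: "strict_mono t" and pos: "\<And>n. 0 < t n" and C: "\<And>n. t n \<le> C * real (Suc n)"
    and top: "filterlim t at_top sequentially"
  shows "\<exists>f :: nat \<Rightarrow> nat. \<forall>i j. i \<noteq> j \<longrightarrow> t (f i) / t (f j) \<notin> {real k | k. 1 \<le> k}"
proof -
  have C0: "0 < C" using pos[of 0] C[of 0] by simp
  have small: "\<forall>\<^sub>F j in sequentially. C / t j < e" if "e > 0" for e
  proof -
    have "\<forall>\<^sub>F j in sequentially. C / e < t j"
      using top by (simp add: filterlim_at_top_dense)
    then show ?thesis
      by eventually_elim (use that pos in \<open>simp add: field_simps\<close>)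
  qed
  define P where "P = (\<lambda>S. finite S \<and> S \<noteq> {} \<and> (\<Sum>i\<in>S. C / t i) < 1)"
  define Q where "Q = (\<lambda>S S'. \<exists>j. S' = insert j S \<and>
      (\<forall>i\<in>S. i < j \<and> t j / t i \<notin> {real k | k. 1 \<le> k}))"
  have "\<exists>f. \<forall>n. P (f n) \<and> Q (f n) (f (Suc n))"
  proof (rule dependent_nat_choice)
    obtain j where "C / t j < 1" using small[of 1] by (auto simp: eventually_sequentially)
    then have "P {j}" by (simp add: P_def)
    then show "\<exists>S. P S" ..
  next
    fix S :: "nat set" assume "P S"
    then have S: "finite S" "(\<Sum>i\<in>S. C / t i) < 1" "S \<noteq> {}" by (auto simp: P_def)
    obtain B where B: "\<And>j. j \<ge> B \<Longrightarrow> C / t j < 1 - (\<Sum>i\<in>S. C / t i)"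
      using small[of "1 - (\<Sum>i\<in>S. C / t i)"] S(2) by (auto simp: eventually_sequentially)
    obtain j where j: "j \<ge> max B (Suc (Max S))" "\<forall>i\<in>S. t j / t i \<notin> {real k | k. 1 \<le> k}"
      using exists_nonmultiple[OF t pos C S(1,2)] by blast
    have lt: "i < j" if "i \<in> S" for i using Max_ge[OF S(1) that] j(1) by simp
    then have "j \<notin> S" by blast
    then have "P (insert j S)" using S B[of j] j(1) by (simp add: P_def)
    moreover have "Q S (insert j S)" using lt j(2) by (auto simp: Q_def)
    ultimately show "\<exists>S'. P S' \<and> Q S S'" by blast
  qed
  then obtain F where F: "\<And>n. P (F n)" "\<And>n. Q (F n) (F (Suc n))" by blast
  define f where "f = (\<lambda>n. Max (F n))"
  have "F n \<subseteq> F (Suc n)" for n using F(2)[of n] unfolding Q_def by blast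
  then have mono: "F m \<subseteq> F n" if "m \<le> n" for m n
    using lift_Suc_mono_le[of F m n] that by blast
  have fin: "f n \<in> F n" for n using F(1)[of n] by (simp add: f_def P_def)
  have step: "i < f (Suc n) \<and> t (f (Suc n)) / t i \<notin> {real k | k. 1 \<le> k}" if "i \<in> F n" for i n
  proof -
    obtain j where j: "F (Suc n) = insert j (F n)"
      "\<forall>i\<in>F n. i < j \<and> t j / t i \<notin> {real k | k. 1 \<le> k}"
      using F(2)[of n] by (auto simp: Q_def)
    have "f (Suc n) = j" unfolding f_def j(1)
      using F(1)[of n] j(2) by (intro Max_eqI) (auto simp: P_def less_imp_le)
    then show ?thesis using j(2) that by blast
  qed
  have lt: "f m < f n \<and> t (f n) / t (f m) \<notin> {real k | k. 1 \<le> k}" if "m < n" for m n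
  proof -
    have "m \<le> n - 1" "Suc (n - 1) = n" using that by auto
    then have "f m \<in> F (n - 1)" "Suc (n - 1) = n" using fin[of m] mono[of m "n - 1"] by auto
    then show ?thesis using step[of "f m" "n - 1"] by simp
  qed
  have both: "t (f m) / t (f n) \<notin> {real k | k. 1 \<le> k} \<and> t (f n) / t (f m) \<notin> {real k | k. 1 \<le> k}"
    if "m < n" for m n
  proof -
    have "t (f m) / t (f n) < 1" using lt[OF that] strict_monoD[OF t] pos[of "f n"] by simp
    then show ?thesis using lt[OF that] by auto
  qed
  show ?thesis
  proof (intro exI[of _ f] allI impI)
    fix i j :: nat assume "i \<noteq> j"
    then have "i < j \<or> j < i" by linarith
    then show "t (f i) / t (f j) \<notin> {real k | k. 1 \<le> k}" using both by blast
  qed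
qed

section \<open>Integrals over circles\<close>

text \<open>The integral of \<open>k\<close>, viewed as a function of the ordinate alone, over the circle of radius \<open>r\<close> with
respect to the angle.\<close>

definition circle_int :: "(real \<Rightarrow> real) \<Rightarrow> real \<Rightarrow> real" where
  "circle_int k r = integral {0..2*pi} (\<lambda>\<phi>. k (r * sin \<phi>))"

lemma abs_mult_sin_le:
  fixes r \<phi> :: real
  shows "\<bar>r * sin \<phi>\<bar> \<le> \<bar>r\<bar>"
  by (simp add: abs_mult mult_left_le)

lemma continuous_on_sin_circle:
  fixes k :: "real \<Rightarrow> real"
  assumes "continuous_on {-1<..<1} k" "\<bar>r\<bar> < 1"
  shows "continuous_on S (\<lambda>\<phi>. k (r * sin \<phi>))"
proof (rule continuous_on_compose2[OF assms(1)])
  have "r * sin \<phi> \<in> {-1<..<1}" for \<phi>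
    using abs_mult_sin_le[of r \<phi>] assms(2) by auto
  then show "(\<lambda>\<phi>. r * sin \<phi>) ` S \<subseteq> {- 1<..<1}"
    by blast
qed (intro continuous_intros)

lemma continuous_on_circle_int:
  assumes k: "continuous_on {-1<..<1} k"
  shows "continuous_on {-1<..<1} (circle_int k)"
proof -
  have "continuous_on ({-1<..<1} \<times> cbox 0 (2*pi)) (\<lambda>(r, \<phi>). k (r * sin \<phi>))"
    unfolding split_beta
  proof (rule continuous_on_compose2[OF k])
    show "(\<lambda>x. fst x * sin (snd x)) ` ({- 1<..<1} \<times> cbox 0 (2 * pi)) \<subseteq> {- 1<..<1::real}"
    proof clarify
      fix r \<phi> :: real assume "r \<in> {-1<..<1}"
      then show "fst (r, \<phi>) * sin (snd (r, \<phi>)) \<in> {- 1<..<1}"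
        using abs_mult_sin_le[of r \<phi>] by auto
    qed
  qed (intro continuous_intros)
  from integral_continuous_on_param[OF this] show ?thesis
    by (simp add: circle_int_def[abs_def])
qed

text \<open>In polar coordinates the integral of \<open>k v\<close> over the disc of radius \<open>r\<close>, \<open>v\<close> being the ordinate, has the
derivative \<open>r * circle_int k r\<close>; sliced along lines of constant \<open>v\<close> and with \<open>v = r sin \<phi>\<close>, the same
integral becomes the function differentiated here. The proof replaces the change of variables by two
integrations by parts with an antiderivative \<open>K\<close> of the merely continuous function \<open>k\<close>.\<close>

lemma circle_int_area_derivative:
  assumes k: "continuous_on {-1<..<1} k" and r: "\<bar>r\<bar> < 1"
  shows "((\<lambda>\<rho>. circle_int (\<lambda>v. k v * (\<rho>\<^sup>2 - v\<^sup>2)) \<rho>) has_real_derivative r * circle_int k r) (at r)"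
proof -
  obtain R where R: "\<bar>r\<bar> < R" "R < 1" using dense[OF r] by blast
  have "continuous_on {-R..R} k" by (rule continuous_on_subset[OF k]) (use R in auto)
  then obtain K where K0: "\<And>x. x \<in> {-R..R} \<Longrightarrow> (K has_vector_derivative k x) (at x within {-R..R})"
    using antiderivative_continuous by blast
  have K: "(K has_real_derivative k x) (at x)" if "\<bar>x\<bar> < R" for x
    using K0[of x] that at_within_Icc_at[of "-R" x R]
    by (simp add: has_real_derivative_iff_has_vector_derivative abs_less_iff)
  have bd: "\<bar>\<rho> * sin \<phi>\<bar> < R" if "\<bar>\<rho>\<bar> < R" for \<rho> \<phi>
    using abs_mult_sin_le[of \<rho> \<phi>] that by linarith
  note KD[derivative_intros] = DERIV_chain'[OF _ K]
  have Kc: "continuous_on {-R<..<R} K"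
    by (intro continuous_at_imp_continuous_on ballI DERIV_isCont[OF K]) auto
  have kc: "continuous_on {-R<..<R} k" by (rule continuous_on_subset[OF k]) (use R in auto)
  have cont: "continuous_on ({-R<..<R} \<times> cbox 0 (2*pi)) (\<lambda>x. f (fst x * sin (snd x)))"
    if "continuous_on {-R<..<R} f" for f :: "real \<Rightarrow> real"
  proof (rule continuous_on_compose2[OF that])
    show "(\<lambda>x. fst x * sin (snd x)) ` ({-R<..<R} \<times> cbox 0 (2 * pi)) \<subseteq> {-R<..<R}"
    proof clarify
      fix r \<phi> :: real assume "r \<in> {-R<..<R}"
      then show "fst (r, \<phi>) * sin (snd (r, \<phi>)) \<in> {-R<..<R}"
        using bd[of r \<phi>] by (simp add: abs_less_iff)
    qed
  qed (intro continuous_intros)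
  have cont1: "continuous_on S (\<lambda>\<phi>. f (\<rho> * sin \<phi>))"
    if "continuous_on {-R<..<R} f" "\<bar>\<rho>\<bar> < R" for f :: "real \<Rightarrow> real" and \<rho> S
    by (rule continuous_on_compose2[OF that(1)])
       (use bd[OF that(2)] in \<open>auto intro!: continuous_intros simp: abs_less_iff minus_less_iff\<close>)
  \<comment> \<open>Integrating by parts rewrites the area in terms of \<open>K\<close>, so that the Leibniz rule applies.\<close>
  define g where "g = (\<lambda>\<rho>. integral {0..2*pi} (\<lambda>\<phi>. K (\<rho> * sin \<phi>) * (\<rho> * sin \<phi>)))"
  have g_eq: "circle_int (\<lambda>v. k v * (\<rho>\<^sup>2 - v\<^sup>2)) \<rho> = g \<rho>" if \<rho>: "\<bar>\<rho>\<bar> < R" for \<rho>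
  proof -
    have "((\<lambda>\<phi>. k (\<rho> * sin \<phi>) * (\<rho> * cos \<phi>) * (\<rho> * cos \<phi>) - K (\<rho> * sin \<phi>) * (\<rho> * sin \<phi>))
        has_integral (K (\<rho> * sin (2*pi)) * (\<rho> * cos (2*pi)) - K (\<rho> * sin 0) * (\<rho> * cos 0))) {0..2*pi}"
    proof (rule fundamental_theorem_of_calculus)
      fix \<phi> :: real
      have "((\<lambda>\<phi>. K (\<rho> * sin \<phi>) * (\<rho> * cos \<phi>)) has_real_derivative
        (k (\<rho> * sin \<phi>) * (\<rho> * cos \<phi>) * (\<rho> * cos \<phi>) - K (\<rho> * sin \<phi>) * (\<rho> * sin \<phi>))) (at \<phi>)"
        by (rule derivative_eq_intros refl bd[OF \<rho>])+ (simp add: algebra_simps)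
      then show "((\<lambda>\<phi>. K (\<rho> * sin \<phi>) * (\<rho> * cos \<phi>)) has_vector_derivative
        (k (\<rho> * sin \<phi>) * (\<rho> * cos \<phi>) * (\<rho> * cos \<phi>) - K (\<rho> * sin \<phi>) * (\<rho> * sin \<phi>))) (at \<phi> within {0..2*pi})"
        by (simp add: has_real_derivative_iff_has_vector_derivative has_vector_derivative_at_within)
    qed simp
    then have "integral {0..2*pi} (\<lambda>\<phi>. k (\<rho> * sin \<phi>) * (\<rho> * cos \<phi>) * (\<rho> * cos \<phi>) - K (\<rho> * sin \<phi>) * (\<rho> * sin \<phi>)) = 0"
      by (simp add: integral_unique)
    moreover have "integral {0..2*pi} (\<lambda>\<phi>. k (\<rho> * sin \<phi>) * (\<rho> * cos \<phi>) * (\<rho> * cos \<phi>) - K (\<rho> * sin \<phi>) * (\<rho> * sin \<phi>))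
       = integral {0..2*pi} (\<lambda>\<phi>. k (\<rho> * sin \<phi>) * (\<rho> * cos \<phi>) * (\<rho> * cos \<phi>)) - g \<rho>"
      unfolding g_def
      by (intro integral_diff integrable_continuous_real continuous_intros cont1[OF kc \<rho>] cont1[OF Kc \<rho>])
    moreover have "k (\<rho> * sin \<phi>) * (\<rho> * cos \<phi>) * (\<rho> * cos \<phi>) = k (\<rho> * sin \<phi>) * (\<rho>\<^sup>2 - (\<rho> * sin \<phi>)\<^sup>2)" for \<phi>
    proof -
      have "\<rho>\<^sup>2 - (\<rho> * sin \<phi>)\<^sup>2 = \<rho>\<^sup>2 * (cos \<phi>)\<^sup>2"
        by (simp add: power_mult_distrib cos_squared_eq right_diff_distrib)
      then show ?thesis by (simp add: power2_eq_square)
    qed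
    ultimately show ?thesis by (simp add: circle_int_def)
  qed
  have "(g has_real_derivative
      integral {0..2*pi} (\<lambda>\<phi>. k (r * sin \<phi>) * sin \<phi> * (r * sin \<phi>) + K (r * sin \<phi>) * sin \<phi>)) (at r within {-R<..<R})"
    unfolding g_def cbox_interval[symmetric]
  proof (rule leibniz_rule_field_derivative)
    fix \<rho> \<phi> :: real assume "\<rho> \<in> {-R<..<R}"
    then have "\<bar>\<rho> * sin \<phi>\<bar> < R" by (intro bd) auto
    then have "((\<lambda>\<rho>. K (\<rho> * sin \<phi>) * (\<rho> * sin \<phi>)) has_real_derivative
      k (\<rho> * sin \<phi>) * sin \<phi> * (\<rho> * sin \<phi>) + K (\<rho> * sin \<phi>) * sin \<phi>) (at \<rho>)"
      by (auto intro!: derivative_eq_intros)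
    then show "((\<lambda>\<rho>. K (\<rho> * sin \<phi>) * (\<rho> * sin \<phi>)) has_real_derivative
      k (\<rho> * sin \<phi>) * sin \<phi> * (\<rho> * sin \<phi>) + K (\<rho> * sin \<phi>) * sin \<phi>) (at \<rho> within {-R<..<R})"
      by (rule has_field_derivative_at_within)
  next
    fix \<rho> assume "\<rho> \<in> {-R<..<R}"
    then show "(\<lambda>\<phi>. K (\<rho> * sin \<phi>) * (\<rho> * sin \<phi>)) integrable_on cbox 0 (2 * pi)"
      by (intro integrable_continuous continuous_intros cont1[OF Kc]) auto
  next
    show "continuous_on ({-R<..<R} \<times> cbox 0 (2 * pi))
     (\<lambda>(\<rho>, \<phi>). k (\<rho> * sin \<phi>) * sin \<phi> * (\<rho> * sin \<phi>) + K (\<rho> * sin \<phi>) * sin \<phi>)"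
      unfolding split_beta by (intro continuous_intros cont[OF kc] cont[OF Kc])
  qed (use R in auto)
  then have gD: "(g has_real_derivative
      integral {0..2*pi} (\<lambda>\<phi>. k (r * sin \<phi>) * sin \<phi> * (r * sin \<phi>) + K (r * sin \<phi>) * sin \<phi>)) (at r)"
    using R by (simp add: at_within_open[of r "{-R<..<R}"] abs_less_iff)
  \<comment> \<open>A second integration by parts eliminates \<open>K\<close> from the derivative.\<close>
  have "((\<lambda>\<phi>. K (r * sin \<phi>) * sin \<phi> - k (r * sin \<phi>) * (r * cos \<phi>) * cos \<phi>)
        has_integral (- K (r * sin (2*pi)) * cos (2*pi) - (- K (r * sin 0) * cos 0))) {0..2*pi}"
  proof (rule fundamental_theorem_of_calculus)
    fix \<phi> :: real
    have "((\<lambda>\<phi>. - K (r * sin \<phi>) * cos \<phi>) has_real_derivative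
        (K (r * sin \<phi>) * sin \<phi> - k (r * sin \<phi>) * (r * cos \<phi>) * cos \<phi>)) (at \<phi>)"
      by (rule derivative_eq_intros refl bd[OF R(1)])+ (simp add: algebra_simps)
    then show "((\<lambda>\<phi>. - K (r * sin \<phi>) * cos \<phi>) has_vector_derivative
        (K (r * sin \<phi>) * sin \<phi> - k (r * sin \<phi>) * (r * cos \<phi>) * cos \<phi>)) (at \<phi> within {0..2*pi})"
      by (simp add: has_real_derivative_iff_has_vector_derivative has_vector_derivative_at_within)
  qed simp
  then have parts: "((\<lambda>\<phi>. K (r * sin \<phi>) * sin \<phi> - k (r * sin \<phi>) * (r * cos \<phi>) * cos \<phi>) has_integral 0) {0..2*pi}"
    by simp
  have "((\<lambda>\<phi>. r * k (r * sin \<phi>)) has_integral r * circle_int k r) {0..2*pi}"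
    unfolding circle_int_def
    by (intro has_integral_mult_right integrable_integral integrable_continuous_real cont1[OF kc R(1)])
  from has_integral_add[OF this parts]
  have "((\<lambda>\<phi>. r * k (r * sin \<phi>) + (K (r * sin \<phi>) * sin \<phi> - k (r * sin \<phi>) * (r * cos \<phi>) * cos \<phi>))
      has_integral r * circle_int k r) {0..2*pi}" by simp
  then have "((\<lambda>\<phi>. k (r * sin \<phi>) * sin \<phi> * (r * sin \<phi>) + K (r * sin \<phi>) * sin \<phi>) has_integral r * circle_int k r) {0..2*pi}"
  proof (rule has_integral_eq[rotated])
    fix \<phi> :: real
    have "sin \<phi> * sin \<phi> + cos \<phi> * cos \<phi> = 1" by (simp flip: power2_eq_square)
    then show "r * k (r * sin \<phi>) + (K (r * sin \<phi>) * sin \<phi> - k (r * sin \<phi>) * (r * cos \<phi>) * cos \<phi>) =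
      k (r * sin \<phi>) * sin \<phi> * (r * sin \<phi>) + K (r * sin \<phi>) * sin \<phi>"
      by algebra
  qed
  then have gD': "(g has_real_derivative r * circle_int k r) (at r)" using gD by (simp add: integral_unique)
  show ?thesis
    by (rule has_field_derivative_transform_within_open[OF gD', of "{-R<..<R}"])
       (use R g_eq in auto)
qed

text \<open>The angle by which an orbit turns during one radial oscillation, if \<open>h\<close> is the time density along the
circle of radius \<open>r\<close>.\<close>

definition turn :: "(real \<Rightarrow> real) \<Rightarrow> real \<Rightarrow> real" where
  "turn h r = sqrt (1 - r\<^sup>2) * circle_int (\<lambda>v. h v / (1 - v\<^sup>2)) r"

lemma sq_less_1: "\<bar>r\<bar> < 1 \<Longrightarrow> r\<^sup>2 < (1::real)"
  by (simp add: abs_square_less_1)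

lemma sin_circle_in:
  fixes r \<phi> :: real
  shows "\<bar>r\<bar> < 1 \<Longrightarrow> r * sin \<phi> \<in> {-1<..<1}"
  using abs_mult_sin_le[of r \<phi>] by auto

lemma continuous_on_weighted:
  fixes h :: "real \<Rightarrow> real"
  assumes "continuous_on {-1<..<1} h"
  shows "continuous_on {-1<..<1} (\<lambda>v. h v / (1 - v\<^sup>2))"
proof (intro continuous_intros assms ballI)
  fix v :: real assume "v \<in> {-1<..<1}"
  then have "v\<^sup>2 < 1" by (intro sq_less_1) auto
  then show "1 - v\<^sup>2 \<noteq> 0" by simp
qed

lemma circle_int_integrable:
  fixes k :: "real \<Rightarrow> real"
  assumes "continuous_on {-1<..<1} k" "\<bar>r\<bar> < 1"
  shows "(\<lambda>\<phi>. k (r * sin \<phi>)) integrable_on {0..2*pi}"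
  by (intro integrable_continuous_real continuous_on_sin_circle assms)

lemma circle_int_lincomb:
  fixes f g :: "real \<Rightarrow> real"
  assumes "continuous_on {-1<..<1} f" "continuous_on {-1<..<1} g" "\<bar>r\<bar> < 1"
  shows "circle_int (\<lambda>v. a * f v + b * g v) r = a * circle_int f r + b * circle_int g r"
  unfolding circle_int_def
  by (subst integral_add) (auto intro!: integrable_on_mult_right circle_int_integrable assms)

lemma circle_int_cong:
  assumes "\<bar>r\<bar> < 1" "\<And>v. v \<in> {-1<..<1} \<Longrightarrow> f v = g v"
  shows "circle_int f r = circle_int g r"
  unfolding circle_int_def using assms sin_circle_in[OF assms(1)] by simp

lemma circle_int_mono:
  fixes f g :: "real \<Rightarrow> real"
  assumes "continuous_on {-1<..<1} f" "continuous_on {-1<..<1} g" "\<bar>r\<bar> < 1"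
    and "\<And>v. v \<in> {-1<..<1} \<Longrightarrow> f v \<le> g v"
  shows "circle_int f r \<le> circle_int g r"
  unfolding circle_int_def
  by (intro integral_le circle_int_integrable assms sin_circle_in)

lemma circle_int_reflect:
  fixes f :: "real \<Rightarrow> real"
  assumes "continuous_on {-1<..<1} f" "\<bar>r\<bar> < 1"
  shows "circle_int (\<lambda>v. f (- v)) r = circle_int f r"
proof -
  have "((\<lambda>\<phi>. f (r * sin \<phi>)) has_integral circle_int f r) (cbox 0 (2*pi))"
    unfolding circle_int_def cbox_interval by (intro integrable_integral circle_int_integrable assms)
  from has_integral_affinity[OF this, of "-1" "2*pi"]
  have "((\<lambda>\<phi>. f (r * sin (2*pi - \<phi>))) has_integral circle_int f r) ((\<lambda>\<phi>. 2*pi - \<phi>) ` {0..2*pi})"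
    by (simp add: algebra_simps)
  moreover have "(\<lambda>\<phi>. 2*pi - \<phi>) ` {0..2*pi} = {0..2*pi}" by simp
  moreover have "sin (2*pi - \<phi>) = - sin \<phi>" for \<phi> :: real by (simp add: sin_diff)
  ultimately show ?thesis by (simp add: circle_int_def integral_unique)
qed

lemma continuous_on_turn:
  assumes "continuous_on {-1<..<1} h"
  shows "continuous_on {-1<..<1} (turn h)"
  unfolding turn_def
  by (intro continuous_intros continuous_on_circle_int continuous_on_weighted assms)

text \<open>The splitting \<open>1 - v\<^sup>2 = (r\<^sup>2 - v\<^sup>2) + (1 - r\<^sup>2)\<close>. In mechanical terms the period is the sum of the radial
action and the product of angular momentum and turning angle.\<close>

lemma circle_int_decompose:
  assumes h: "continuous_on {-1<..<1} h" and r: "\<bar>r\<bar> < 1"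
  shows "circle_int h r
    = circle_int (\<lambda>v. h v / (1 - v\<^sup>2) * (r\<^sup>2 - v\<^sup>2)) r + sqrt (1 - r\<^sup>2) * turn h r"
proof -
  note w = continuous_on_weighted[OF h]
  have "circle_int h r = circle_int (\<lambda>v. 1 * (h v / (1 - v\<^sup>2) * (r\<^sup>2 - v\<^sup>2)) + (1 - r\<^sup>2) * (h v / (1 - v\<^sup>2))) r"
  proof (rule circle_int_cong[OF r])
    fix v :: real assume "v \<in> {-1<..<1}"
    then have "v\<^sup>2 < 1" by (intro sq_less_1) auto
    then show "h v = 1 * (h v / (1 - v\<^sup>2) * (r\<^sup>2 - v\<^sup>2)) + (1 - r\<^sup>2) * (h v / (1 - v\<^sup>2))"
      by (simp add: divide_simps) (simp add: algebra_simps)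
  qed
  also have "\<dots> = 1 * circle_int (\<lambda>v. h v / (1 - v\<^sup>2) * (r\<^sup>2 - v\<^sup>2)) r
      + (1 - r\<^sup>2) * circle_int (\<lambda>v. h v / (1 - v\<^sup>2)) r"
    by (intro circle_int_lincomb w r continuous_intros)
  also have "(1 - r\<^sup>2) = sqrt (1 - r\<^sup>2) * sqrt (1 - r\<^sup>2)" using sq_less_1[OF r] by simp
  finally show ?thesis by (simp add: turn_def)
qed

text \<open>This is the integral of the Poisson kernel. Let \<open>P\<close> be the integral of \<open>1 / (1 - v\<^sup>2)\<close> and \<open>g\<close> the area
function belonging to it. Then \<open>2 \<pi> - g = (1 - r\<^sup>2) P\<close> and \<open>g' = r P\<close>, a linear differential equation
for \<open>2 \<pi> - g\<close> with solution \<open>2 \<pi> sqrt (1 - r\<^sup>2)\<close>.\<close>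

lemma turn_const_1:
  assumes r: "\<bar>r\<bar> < 1"
  shows "turn (\<lambda>_. 1) r = 2 * pi"
proof -
  define P where "P = circle_int (\<lambda>v. 1 / (1 - v\<^sup>2))"
  define g where "g = (\<lambda>r. circle_int (\<lambda>v. 1 / (1 - v\<^sup>2) * (r\<^sup>2 - v\<^sup>2)) r)"
  have c: "continuous_on {-1<..<1} (\<lambda>_. 1::real)" by simp
  have gD: "(g has_real_derivative r * P r) (at r)" if "\<bar>r\<bar> < 1" for r
    unfolding g_def P_def by (rule circle_int_area_derivative[OF continuous_on_weighted[OF c] that])
  have gP: "2 * pi - g r = (1 - r\<^sup>2) * P r" if "\<bar>r\<bar> < 1" for r
    using circle_int_decompose[OF c that] sq_less_1[OF that]
    by (simp add: turn_def g_def P_def circle_int_def[of "\<lambda>_. 1"])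
  define u where "u = (\<lambda>r. (2 * pi - g r) / sqrt (1 - r\<^sup>2))"
  have uD: "(u has_real_derivative 0) (at r)" if "\<bar>r\<bar> < 1" for r
  proof -
    have lt: "r\<^sup>2 < 1" by (rule sq_less_1[OF that])
    have sD: "((\<lambda>r. sqrt (1 - r\<^sup>2)) has_real_derivative - r / sqrt (1 - r\<^sup>2)) (at r)"
      using lt by (auto intro!: derivative_eq_intros simp: field_simps)
    have "(u has_real_derivative ((0 - r * P r) * sqrt (1 - r\<^sup>2) - (2 * pi - g r) * (- r / sqrt (1 - r\<^sup>2)))
        / (sqrt (1 - r\<^sup>2) * sqrt (1 - r\<^sup>2))) (at r)"
      unfolding u_def
      by (intro DERIV_divide DERIV_diff DERIV_const gD[OF that] sD) (use lt in simp)
    moreover have "(0 - r * P r) * sqrt (1 - r\<^sup>2) - (2 * pi - g r) * (- r / sqrt (1 - r\<^sup>2)) = 0"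
      by (subst gP[OF that]) (use lt in \<open>simp add: field_simps\<close>)
    ultimately show ?thesis by (simp only:) simp
  qed
  have "u r = u 0"
    by (rule DERIV_isconst3[of "-1" 1]) (use r uD in auto)
  moreover have "u 0 = 2 * pi" by (simp add: u_def g_def circle_int_def)
  moreover have "turn (\<lambda>_. 1) r = u r"
  proof -
    have "u r = (1 - r\<^sup>2) / sqrt (1 - r\<^sup>2) * P r" unfolding u_def gP[OF r] by simp
    then show ?thesis using sq_less_1[OF r] by (simp add: turn_def P_def real_div_sqrt)
  qed
  ultimately show ?thesis by simp
qed

text \<open>By the area derivative, the function \<open>\<rho> \<mapsto> g \<rho> + s \<rho> * turn h r1\<close> with \<open>s \<rho> = sqrt (1 - \<rho>\<^sup>2)\<close> has the derivative
\<open>\<rho> / s \<rho> * (turn h \<rho> - turn h r1)\<close>, which is nonnegative. It agrees with the period at \<open>r1\<close> and is at most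
the period at \<open>r2\<close>.\<close>

lemma circle_int_le_of_turn_ge:
  assumes h: "continuous_on {-1<..<1} h" and r: "0 \<le> r1" "r1 \<le> r2" "r2 < 1"
    and ge: "\<And>\<rho>. \<rho> \<in> {r1..r2} \<Longrightarrow> turn h r1 \<le> turn h \<rho>"
  shows "circle_int h r1 \<le> circle_int h r2"
proof -
  define g where "g = (\<lambda>r. circle_int (\<lambda>v. h v / (1 - v\<^sup>2) * (r\<^sup>2 - v\<^sup>2)) r)"
  have dec: "circle_int h \<rho> = g \<rho> + sqrt (1 - \<rho>\<^sup>2) * turn h \<rho>" if "\<bar>\<rho>\<bar> < 1" for \<rho>
    unfolding g_def by (rule circle_int_decompose[OF h that])
  define M where "M = (\<lambda>\<rho>. g \<rho> + sqrt (1 - \<rho>\<^sup>2) * turn h r1)"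
  have "M r1 \<le> M r2"
  proof (rule DERIV_nonneg_imp_nondecreasing[OF r(2)])
    fix \<rho> assume \<rho>: "r1 \<le> \<rho>" "\<rho> \<le> r2"
    then have lt: "\<bar>\<rho>\<bar> < 1" "\<rho>\<^sup>2 < 1" using r sq_less_1[of \<rho>] by auto
    have sD: "((\<lambda>r. sqrt (1 - r\<^sup>2)) has_real_derivative - \<rho> / sqrt (1 - \<rho>\<^sup>2)) (at \<rho>)"
      using lt by (auto intro!: derivative_eq_intros simp: field_simps)
    have "(M has_real_derivative
        \<rho> * circle_int (\<lambda>v. h v / (1 - v\<^sup>2)) \<rho> + (- \<rho> / sqrt (1 - \<rho>\<^sup>2)) * turn h r1) (at \<rho>)"
      unfolding M_def g_def
      by (intro DERIV_add DERIV_cmult_right sD circle_int_area_derivative continuous_on_weighted h lt)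
    moreover have "\<rho> * circle_int (\<lambda>v. h v / (1 - v\<^sup>2)) \<rho> + (- \<rho> / sqrt (1 - \<rho>\<^sup>2)) * turn h r1
        = \<rho> / sqrt (1 - \<rho>\<^sup>2) * (turn h \<rho> - turn h r1)"
      using lt by (simp add: turn_def field_simps)
    moreover have "0 \<le> \<rho> / sqrt (1 - \<rho>\<^sup>2) * (turn h \<rho> - turn h r1)"
      using ge[of \<rho>] \<rho> r lt by simp
    ultimately show "\<exists>y. (M has_real_derivative y) (at \<rho>) \<and> 0 \<le> y" by metis
  qed
  moreover have "sqrt (1 - r2\<^sup>2) * turn h r1 \<le> sqrt (1 - r2\<^sup>2) * turn h r2"
    using ge[of r2] r sq_less_1[of r2] by (intro mult_left_mono) auto
  ultimately show ?thesis using dec[of r1] dec[of r2] r by (simp add: M_def)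
qed

text \<open>Only the even part \<open>e\<close> of \<open>h\<close> contributes to the turning angle. The kernel \<open>sqrt (1 - r\<^sup>2) / (1 - v\<^sup>2)\<close>
has total mass \<open>2 \<pi>\<close> and concentrates at \<open>v = 1\<close> and \<open>v = - 1\<close> as \<open>r\<close> tends to one, so that the limit is
\<open>2 \<pi> e 1\<close>, whereas the value at zero is \<open>2 \<pi> h 0\<close>.\<close>

lemma exists_turn_gt:
  assumes h: "continuous_on {-1..1} h" and nonneg: "\<And>v. v \<in> {-1..1} \<Longrightarrow> 0 \<le> h v"
    and gt: "2 * h 0 < h 1 + h (-1)"
  shows "\<exists>R. 0 < R \<and> R < 1 \<and> turn h 0 < turn h R"
proof -
  define e where "e = (\<lambda>v. (h v + h (- v)) / 2)"
  define d where "d = (e 1 - h 0) / 2"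
  have d: "0 < d" using gt by (simp add: d_def e_def)
  have e: "continuous_on {-1..1} e"
    unfolding e_def by (intro continuous_intros h continuous_on_compose2[OF h]) auto
  have e1: "0 \<le> e 1" using nonneg[of 1] nonneg[of "-1"] by (simp add: e_def)
  obtain \<delta> where \<delta>: "0 < \<delta>" "\<And>v. v \<in> {-1..1} \<Longrightarrow> \<bar>v - 1\<bar> < \<delta> \<Longrightarrow> \<bar>e v - e 1\<bar> < d"
    using e d unfolding continuous_on_iff by (force simp: dist_real_def)
  \<comment> \<open>Near the endpoints \<open>e\<close> exceeds \<open>e 1 - d\<close>; elsewhere \<open>1 - v\<^sup>2\<close> is at least \<open>\<delta>\<close> and pays for \<open>e 1\<close>.\<close>
  have bound: "(e 1 - d) * 1 + (- e 1 / \<delta>) * (1 - v\<^sup>2) \<le> e v" if v: "v \<in> {-1<..<1}" for v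
  proof (cases "1 - \<bar>v\<bar> < \<delta>")
    case True
    have "e v = e \<bar>v\<bar>" by (simp add: e_def abs_if add.commute)
    moreover have "\<bar>e \<bar>v\<bar> - e 1\<bar> < d" by (rule \<delta>(2)) (use True v in auto)
    ultimately have "e 1 - d \<le> e v" by linarith
    moreover have "v\<^sup>2 < 1" using v by (intro sq_less_1) auto
    then have "0 \<le> e 1 / \<delta> * (1 - v\<^sup>2)"
      using e1 \<delta>(1) by (intro mult_nonneg_nonneg) auto
    ultimately show ?thesis by simp
  next
    case False
    have "\<bar>v\<bar> * \<bar>v\<bar> \<le> \<bar>v\<bar> * 1" using v by (intro mult_left_mono) auto
    then have "\<delta> \<le> 1 - v\<^sup>2" using False by (simp add: power2_eq_square)
    then have "e 1 / \<delta> * \<delta> \<le> e 1 / \<delta> * (1 - v\<^sup>2)" using e1 \<delta>(1) by (intro mult_left_mono) auto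
    moreover have "0 \<le> e v" using nonneg[of v] nonneg[of "-v"] v by (simp add: e_def)
    ultimately show ?thesis using d \<delta>(1) by simp
  qed
  have h': "continuous_on {-1<..<1} h" by (rule continuous_on_subset[OF h]) auto
  have hm: "continuous_on {-1<..<1} (\<lambda>v. h (- v))"
    by (rule continuous_on_compose2[OF h']) (auto intro!: continuous_intros)
  have e': "continuous_on {-1<..<1} e" by (rule continuous_on_subset[OF e]) auto
  have lower: "2 * pi * (e 1 - d) - 2 * pi * (e 1 / \<delta>) * sqrt (1 - r\<^sup>2) \<le> turn h r" if r: "\<bar>r\<bar> < 1" for r
  proof -
    have c1: "continuous_on {-1<..<1} (\<lambda>v. 1 / (1 - v\<^sup>2) :: real)"
      by (rule continuous_on_weighted) simp
    note w = continuous_on_weighted[OF h'] continuous_on_weighted[OF hm]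
    have "circle_int (\<lambda>v. e v / (1 - v\<^sup>2)) r
        = circle_int (\<lambda>v. 1/2 * (h v / (1 - v\<^sup>2)) + 1/2 * (h (- v) / (1 - v\<^sup>2))) r"
      by (simp add: e_def add_divide_distrib)
    also have "\<dots> = 1/2 * circle_int (\<lambda>v. h v / (1 - v\<^sup>2)) r + 1/2 * circle_int (\<lambda>v. h (- v) / (1 - v\<^sup>2)) r"
      by (rule circle_int_lincomb[OF w r])
    also have "circle_int (\<lambda>v. h (- v) / (1 - v\<^sup>2)) r = circle_int (\<lambda>v. h v / (1 - v\<^sup>2)) r"
      using circle_int_reflect[OF w(1) r] by simp
    finally have even: "circle_int (\<lambda>v. e v / (1 - v\<^sup>2)) r = circle_int (\<lambda>v. h v / (1 - v\<^sup>2)) r"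
      by simp
    have "(e 1 - d) * circle_int (\<lambda>v. 1 / (1 - v\<^sup>2)) r + (- e 1 / \<delta>) * circle_int (\<lambda>v. 1) r
        = circle_int (\<lambda>v. (e 1 - d) * (1 / (1 - v\<^sup>2)) + (- e 1 / \<delta>) * 1) r"
      by (rule circle_int_lincomb[symmetric, OF c1 _ r]) simp
    also have "\<dots> \<le> circle_int (\<lambda>v. e v / (1 - v\<^sup>2)) r"
    proof (rule circle_int_mono[OF _ continuous_on_weighted[OF e'] r])
      fix v :: real assume v: "v \<in> {-1<..<1}"
      then have "0 < 1 - v\<^sup>2" using sq_less_1[of v] by auto
      then have "(e 1 - d) * (1 / (1 - v\<^sup>2)) + (- e 1 / \<delta>) * 1
          = ((e 1 - d) * 1 + (- e 1 / \<delta>) * (1 - v\<^sup>2)) / (1 - v\<^sup>2)"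
        by (simp add: add_divide_distrib diff_divide_distrib)
      also have "\<dots> \<le> e v / (1 - v\<^sup>2)"
        using bound[OF v] \<open>0 < 1 - v\<^sup>2\<close> by (intro divide_right_mono) auto
      finally show "(e 1 - d) * (1 / (1 - v\<^sup>2)) + (- e 1 / \<delta>) * 1 \<le> e v / (1 - v\<^sup>2)" .
    qed (intro continuous_intros c1)
    finally have "sqrt (1 - r\<^sup>2) * ((e 1 - d) * circle_int (\<lambda>v. 1 / (1 - v\<^sup>2)) r + (- e 1 / \<delta>) * circle_int (\<lambda>v. 1) r)
        \<le> turn h r"
      unfolding turn_def even using sq_less_1[OF r] by (intro mult_left_mono) auto
    then show ?thesis
      using turn_const_1[OF r] by (simp add: turn_def circle_int_def[of "\<lambda>_. 1"] algebra_simps)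
  qed
  have "((\<lambda>r. 2 * pi * (e 1 - d) - 2 * pi * (e 1 / \<delta>) * sqrt (1 - r\<^sup>2)) \<longlongrightarrow>
      2 * pi * (e 1 - d) - 2 * pi * (e 1 / \<delta>) * sqrt (1 - 1\<^sup>2)) (at_left 1)"
    by (intro tendsto_intros)
  moreover have "2 * pi * h 0 < 2 * pi * (e 1 - d) - 2 * pi * (e 1 / \<delta>) * sqrt (1 - 1\<^sup>2)"
    using d by (simp add: d_def field_simps)
  ultimately have "\<forall>\<^sub>F r in at_left 1. 2 * pi * h 0 < 2 * pi * (e 1 - d) - 2 * pi * (e 1 / \<delta>) * sqrt (1 - r\<^sup>2)"
    by (rule order_tendstoD)
  moreover have "\<forall>\<^sub>F r in at_left 1. r \<in> {0<..<1::real}"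
    by (rule eventually_at_leftI[of 0]) auto
  ultimately have "\<forall>\<^sub>F r in at_left (1::real). 0 < r \<and> r < 1 \<and> turn h 0 < turn h r"
  proof eventually_elim
    case (elim r)
    then show ?case using lower[of r] by (simp add: turn_def[of h 0] circle_int_def)
  qed
  then show ?thesis using eventually_happens[of _ "at_left (1::real)"] by (auto simp: trivial_limit_at_left_real)
qed

section \<open>Auxiliary facts on real functions\<close>

text \<open>The largest point of the compact set where \<open>f \<le> c\<close>.\<close>

lemma last_crossing:
  fixes f :: "real \<Rightarrow> real"
  assumes f: "continuous_on {a..b} f" and ab: "a \<le> b" "f a \<le> c" "c \<le> f b"
  shows "\<exists>r\<in>{a..b}. f r = c \<and> (\<forall>\<rho>\<in>{r..b}. c \<le> f \<rho>)"
proof -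
  define S where "S = {r \<in> {a..b}. f r \<in> {..c}}"
  have "S = {a..b} \<inter> ({a..b} \<inter> f -` {..c})" by (auto simp: S_def)
  then have "compact S"
    by (simp only:) (intro compact_Int_closed compact_Icc continuous_closed_preimage[OF f] closed_atMost closed_atLeastAtMost)
  moreover have "a \<in> S" using ab by (simp add: S_def)
  ultimately obtain r where r: "r \<in> S" "\<And>x. x \<in> S \<Longrightarrow> x \<le> r"
    using compact_attains_sup[of S] by blast
  have after: "c < f \<rho>" if "\<rho> \<in> {r<..b}" for \<rho>
    using r(2)[of \<rho>] r(1) that by (force simp: S_def)
  have "f r = c"
  proof (rule ccontr)
    assume "f r \<noteq> c"
    then have lt: "f r < c" using r(1) by (simp add: S_def)
    have "continuous_on {r..b} f" by (rule continuous_on_subset[OF f]) (use r(1) in \<open>auto simp: S_def\<close>)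
    then obtain x where "r \<le> x" "x \<le> b" "f x = c"
      using IVT'[of f r c b] lt ab r(1) by (auto simp: S_def)
    then show False using after[of x] lt by (cases "x = r") auto
  qed
  then show ?thesis using r(1) after by (intro bexI[of _ r]) (force simp: S_def le_less)+
qed

text \<open>An antiderivative of a periodic function gains the same amount over every period, because its increment
over one period has derivative zero.\<close>

lemma periodic_antiderivative:
  fixes f :: "real \<Rightarrow> real"
  assumes f: "continuous_on UNIV f" and per: "\<And>x. f (x + c) = f x" and c: "0 \<le> c"
  shows "\<exists>G. G 0 = 0 \<and> (\<forall>x. (G has_real_derivative f x) (at x)) \<and>
    (\<forall>n. G (c * real n) = real n * integral {0..c} f)"
proof -
  have "isCont f x" for x using f by (simp add: continuous_on_eq_continuous_at)
  then obtain G where "\<And>x. (G has_vector_derivative f x) (at x)"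
    using einterval_antiderivative[of "-\<infinity>" \<infinity> f] by auto
  then have G: "(G has_real_derivative f x) (at x)" for x
    by (simp add: has_real_derivative_iff_has_vector_derivative)
  have "((\<lambda>x. G (x + c) - G x) has_real_derivative 0) (at x)" for x
    using DERIV_diff[OF DERIV_shift[THEN iffD1, OF G[of "x + c"]] G[of x]] by (simp add: per)
  then have const: "G (x + c) - G x = G (0 + c) - G 0" for x
    by (rule DERIV_isconst_all[rule_format, of "\<lambda>x. G (x + c) - G x"])
  have int: "integral {0..c} f = G c - G 0"
    by (intro integral_unique fundamental_theorem_of_calculus c)
       (use G in \<open>auto simp: has_real_derivative_iff_has_vector_derivative intro: has_vector_derivative_at_within\<close>)
  have "G (c * real n) - G 0 = real n * integral {0..c} f" for n
  proof (induction n)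
    case (Suc n)
    have "c * real (Suc n) = c * real n + c" by (simp add: algebra_simps)
    then show ?case using const[of "c * real n"] int Suc by (simp add: algebra_simps)
  qed simp
  moreover have "((\<lambda>x. G x - G 0) has_real_derivative f x) (at x)" for x
    using DERIV_diff[OF G DERIV_const[of "G 0"]] by simp
  ultimately show ?thesis by (intro exI[of _ "\<lambda>x. G x - G 0"]) auto
qed

text \<open>The lower bound \<open>m\<close> makes \<open>G\<close> grow at least linearly in both directions, hence onto.\<close>

lemma increasing_antiderivative_inverse:
  fixes f G :: "real \<Rightarrow> real"
  assumes G: "\<And>x. (G has_real_derivative f x) (at x)" and G0: "G 0 = 0"
    and m: "0 < m" "\<And>x. m \<le> f x"
  shows "\<exists>g. (\<forall>x. g (G x) = x) \<and> (\<forall>t. (g has_real_derivative 1 / f (g t)) (at t))"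
proof -
  have mono: "m * (y - x) \<le> G y - G x" if le: "x \<le> y" for x y
  proof -
    have "G x - m * x \<le> G y - m * y"
    proof (rule DERIV_nonneg_imp_nondecreasing[OF le])
      fix z show "\<exists>D. ((\<lambda>x. G x - m * x) has_real_derivative D) (at z) \<and> 0 \<le> D"
        using m(2)[of z] G by (intro exI[of _ "f z - m"]) (auto intro!: derivative_eq_intros)
    qed
    then show ?thesis by (simp add: algebra_simps)
  qed
  have cont: "isCont G x" for x using G by (rule DERIV_isCont)
  have inj: "inj G"
  proof (rule injI)
    fix x y assume "G x = G y"
    moreover have "G x < G y" if "x < y" for x y
      using mono[of x y] that mult_pos_pos[OF m(1), of "y - x"] by simp
    ultimately show "x = y" by (metis less_irrefl linorder_cases)
  qed
  have surj: "\<exists>x. G x = t" for t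
  proof -
    define b where "b = \<bar>t\<bar> / m"
    have b: "0 \<le> b" "m * b = \<bar>t\<bar>" using m(1) by (auto simp: b_def)
    have "G (-b) \<le> t" "t \<le> G b" using mono[of 0 b] mono[of "-b" 0] b G0 by auto
    then show ?thesis using IVT[of G "-b" t b] cont b by auto
  qed
  define g where "g = inv G"
  have gG: "g (G x) = x" for x using inj by (simp add: g_def)
  have Gg: "G (g t) = t" for t using surj[of t] gG by auto
  have "(g has_real_derivative 1 / f (g t)) (at t)" for t
  proof -
    have "isCont g (G (g t))"
      by (rule isCont_inverse_function[of 1]) (auto simp: gG cont)
    then have "(g has_real_derivative inverse (f (g t))) (at t)"
      using m(1) m(2)[of "g t"]
      by (intro DERIV_inverse_function[where f = G and a = "t - 1" and b = "t + 1", OF G]) (auto simp: Gg)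
    then show ?thesis by (simp add: divide_inverse)
  qed
  then show ?thesis using gG by blast
qed

lemma has_vector_derivative_cis:
  assumes "(\<theta> has_real_derivative D) (at t)"
  shows "((\<lambda>t. cis (\<theta> t)) has_vector_derivative \<i> * of_real D * cis (\<theta> t)) (at t)"
proof -
  have "(cis has_vector_derivative \<i> * cis (\<theta> t)) (at (\<theta> t))"
    unfolding has_vector_derivative_def
    by (rule has_derivative_eq_rhs[OF has_derivative_cis]) (auto simp: scaleR_conv_of_real)
  from vector_diff_chain_at[OF assms[unfolded has_real_derivative_iff_has_vector_derivative] this]
  show ?thesis by (simp add: o_def scaleR_conv_of_real mult_ac)
qed

section \<open>The radial potential on the energy level one\<close>

text \<open>Throughout, \<open>a\<close> stands for \<open>|x|^p\<close>. At energy one \<open>bet a\<close> is then \<open>|y|^q\<close>, and \<open>F a = (|x| |y|)^2\<close> is the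
sum of the squares of \<open>x \<bullet> y\<close> and of the angular momentum. The coordinate \<open>V a\<close> straightens the maximum of
\<open>F\<close> at \<open>a = 1\<close>. Since \<open>d(x \<bullet> y)/dt = bet a - a = q (1 - a)\<close>, while \<open>x \<bullet> y = r cos \<phi>\<close> and \<open>V a = r sin \<phi>\<close>,
the time density \<open>dt/d\<phi>\<close> is \<open>V a / (q (a - 1))\<close>, which is \<open>H a\<close>.\<close>

locale conjugate_exponents =
  fixes p q :: real
  assumes p_gt1: "1 < p" and q_def: "q = p / (p - 1)"
begin

lemma q_gt1: "1 < q" using p_gt1 by (simp add: q_def)
lemma pos [simp]: "0 < p" "0 < q" "p \<noteq> 0" "q \<noteq> 0" "p - 1 \<noteq> 0"
  using p_gt1 q_gt1 by auto
lemma q_times: "q * (p - 1) = p" using p_gt1 by (simp add: q_def)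
lemma inverse_exponents_sum: "1 / p + 1 / q = 1" using p_gt1 by (simp add: q_def field_simps)

definition bet :: "real \<Rightarrow> real" where "bet a = (p - a) / (p - 1)"
definition F :: "real \<Rightarrow> real" where "F a = a powr (2 / p) * bet a powr (2 / q)"
definition V :: "real \<Rightarrow> real" where "V a = sgn (a - 1) * sqrt (1 - F a)"
definition H :: "real \<Rightarrow> real" where "H a = (if a = 1 then 1 / sqrt (p * q) else V a / (q * (a - 1)))"

lemma bet_simps [simp]: "bet 1 = 1" "bet 0 = q" "bet p = 0"
  using p_gt1 by (simp_all add: bet_def q_def)

lemma bet_pos: "a < p \<Longrightarrow> 0 < bet a"
  using p_gt1 by (simp add: bet_def)

lemma bet_minus: "bet a - a = q * (1 - a)"
  using p_gt1 by (simp add: bet_def q_def field_simps)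

lemma F_simps [simp]: "F 1 = 1" "F 0 = 0" "F p = 0"
  by (simp_all add: F_def)

lemma F_pos: "0 < a \<Longrightarrow> a < p \<Longrightarrow> 0 < F a"
  using bet_pos[of a] by (simp add: F_def)

lemma continuous_on_F: "continuous_on {0..p} F"
  unfolding F_def bet_def using p_gt1 q_gt1
  by (intro continuous_intros continuous_on_powr') auto

lemma F_deriv:
  assumes "0 < a" "a < p"
  shows "(F has_real_derivative F a * (2 * q * (1 - a) / (p * (a * bet a)))) (at a)"
proof -
  have b: "0 < bet a" by (rule bet_pos[OF assms(2)])
  have bD: "(bet has_real_derivative - 1 / (p - 1)) (at a)"
    unfolding bet_def using p_gt1 by (auto intro!: derivative_eq_intros simp: divide_simps)
  have powrD: "((\<lambda>x. f x powr c) has_real_derivative f x powr c * (c * D / f x)) (at x)"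
    if "(f has_real_derivative D) (at x)" "0 < f x" for f :: "real \<Rightarrow> real" and c D x
    using DERIV_powr[OF that(1,2) DERIV_const[of c]] by (simp add: mult_ac)
  have "(F has_real_derivative F a * (2 / p / a - 2 / q / (p - 1) / bet a)) (at a)"
    unfolding F_def
    by (rule DERIV_cong[OF DERIV_mult[OF powrD[OF DERIV_ident assms(1)] powrD[OF bD b]]])
       (simp add: algebra_simps)
  moreover have "2 / p / a - 2 / q / (p - 1) / bet a = 2 * (bet a - a) / (p * (a * bet a))"
    using assms b q_times by (simp add: field_simps)
  ultimately show ?thesis by (simp add: bet_minus mult.assoc)
qed

lemma F_strict_mono:
  assumes "0 \<le> a" "a < b" "b \<le> 1"
  shows "F a < F b"
proof (rule DERIV_pos_imp_increasing_open[OF assms(2)])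
  fix x assume "a < x" "x < b"
  then have x: "0 < x" "x < 1" "x < p" using p_gt1 assms by auto
  then have "0 < F x * (2 * q * (1 - x) / (p * (x * bet x)))"
    using F_pos[of x] bet_pos[of x] by simp
  then show "\<exists>y. (F has_real_derivative y) (at x) \<and> 0 < y"
    using F_deriv[OF x(1,3)] by blast
qed (use p_gt1 assms in \<open>auto intro: continuous_on_subset[OF continuous_on_F]\<close>)

lemma F_strict_antimono:
  assumes "1 \<le> a" "a < b" "b \<le> p"
  shows "F b < F a"
proof (rule DERIV_neg_imp_decreasing_open[OF assms(2)])
  fix x assume "a < x" "x < b"
  then have x: "0 < x" "1 < x" "x < p" using p_gt1 assms by auto
  then have "F x * (2 * q * (1 - x) / (p * (x * bet x))) < 0"
    using F_pos[of x] bet_pos[of x] by (simp add: mult_pos_neg divide_neg_pos)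
  then show "\<exists>y. (F has_real_derivative y) (at x) \<and> y < 0"
    using F_deriv[OF x(1,3)] by blast
qed (use p_gt1 assms in \<open>auto intro: continuous_on_subset[OF continuous_on_F]\<close>)

lemma F_lt_1: "a \<in> {0..p} \<Longrightarrow> a \<noteq> 1 \<Longrightarrow> F a < 1"
  using F_strict_mono[of a 1] F_strict_antimono[of 1 a] p_gt1 by (cases "a < 1") auto

lemma F_le_1: "a \<in> {0..p} \<Longrightarrow> F a \<le> 1"
  using F_lt_1[of a] by (cases "a = 1") auto

lemma V_simps [simp]: "V 1 = 0" "V 0 = -1" "V p = 1"
  using p_gt1 by (simp_all add: V_def)

lemma V_sq: "a \<in> {0..p} \<Longrightarrow> (V a)\<^sup>2 = 1 - F a"
  using F_le_1[of a] by (auto simp: V_def power_mult_distrib sgn_if)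

lemma V_eq_H: "V a = q * (a - 1) * H a"
  by (simp add: H_def)

lemma V_strict_mono: "strict_mono_on {0..p} V"
proof (rule strict_mono_onI)
  fix a b assume ab: "a \<in> {0..p}" "b \<in> {0..p}" "a < b"
  consider "b \<le> 1" | "1 \<le> a" | "a < 1" "1 < b" using ab by linarith
  then show "V a < V b"
  proof cases
    case 1
    then have "F a < F b" using F_strict_mono ab by auto
    then show ?thesis using 1 ab F_le_1[of b] by (cases "b = 1") (auto simp: V_def sgn_if)
  next
    case 2
    then have "F b < F a" using F_strict_antimono ab by auto
    then show ?thesis using 2 ab F_le_1[of a] by (cases "a = 1") (auto simp: V_def sgn_if)
  next
    case 3
    then show ?thesis using F_lt_1[of a] F_lt_1[of b] ab
      by (auto simp: V_def sgn_if intro: less_trans[of _ 0])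
  qed
qed

lemma H_pos: 
  assumes "a \<in> {0..p}"
  shows "0 < H a"
proof (cases "a = 1")
  case False
  then show ?thesis using F_lt_1[of a] assms by (auto simp: H_def V_def sgn_if field_simps zero_less_divide_iff zero_less_mult_iff)
qed (simp add: H_def)

lemma H_simps: "H 1 = 1 / sqrt (p * q)" "H 0 = 1 / q" "H p = 1 / p"
  using p_gt1 q_times by (simp_all add: H_def)

text \<open>The maximum of \<open>F\<close> at one is nondegenerate. By l'Hospital's rule this follows from the formula for \<open>F'\<close>.\<close>

lemma H_sq_tendsto: "(\<lambda>a. (1 - F a) / (a - 1)\<^sup>2) \<midarrow>1\<rightarrow> q / p"
proof (rule lhopital)
  have c: "isCont F 1" using F_deriv[of 1] p_gt1 by (auto intro: DERIV_isCont)
  show "(\<lambda>a. 1 - F a) \<midarrow>1\<rightarrow> 0" using c by (auto intro!: tendsto_eq_intros simp: isCont_def)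
  show "(\<lambda>a. (a - 1)\<^sup>2) \<midarrow>1\<rightarrow> (0::real)" by (auto intro!: tendsto_eq_intros)
  show "\<forall>\<^sub>F x in at 1. (x - 1)\<^sup>2 \<noteq> (0::real)" by (auto simp: eventually_at_filter)
  show "\<forall>\<^sub>F x in at 1. 2 * (x - 1) \<noteq> (0::real)" by (auto simp: eventually_at_filter)
  have near: "\<forall>\<^sub>F x in at 1. x \<in> {0<..<p} \<and> x \<noteq> (1::real)"
    using p_gt1 eventually_at_in_open[of "{0<..<p}" 1] by (auto elim: eventually_mono)
  show "\<forall>\<^sub>F x in at 1. ((\<lambda>a. 1 - F a) has_real_derivative
      - (F x * (2 * q * (1 - x) / (p * (x * bet x))))) (at x)"
    using near by eventually_elim (auto intro!: derivative_eq_intros F_deriv)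
  show "\<forall>\<^sub>F x in at 1. ((\<lambda>a. (a - 1)\<^sup>2) has_real_derivative 2 * (x - 1)) (at x)"
    by (auto intro!: derivative_eq_intros always_eventually)
  have "(\<lambda>x. F x * q / (p * (x * bet x))) \<midarrow>1\<rightarrow> F 1 * q / (p * (1 * bet 1))"
    using c unfolding bet_def isCont_def by (intro tendsto_intros) (use p_gt1 in auto)
  then have "(\<lambda>x. F x * q / (p * (x * bet x))) \<midarrow>1\<rightarrow> q / p" by simp
  then show "(\<lambda>x. - (F x * (2 * q * (1 - x) / (p * (x * bet x)))) / (2 * (x - 1))) \<midarrow>1\<rightarrow> q / p"
  proof (rule Lim_transform_eventually)
    show "\<forall>\<^sub>F x in at 1. F x * q / (p * (x * bet x)) =
      - (F x * (2 * q * (1 - x) / (p * (x * bet x)))) / (2 * (x - 1))"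
      using near
    proof eventually_elim
      case (elim x)
      then have "x - 1 \<noteq> 0" "x * bet x \<noteq> 0" using bet_pos[of x] by auto
      moreover have "1 - x = - (x - 1)" by simp
      ultimately show ?case by (simp only:) (simp add: divide_simps, simp add: algebra_simps)
    qed
  qed
qed

lemma H_altdef: "a \<in> {0..p} \<Longrightarrow> a \<noteq> 1 \<Longrightarrow> H a = sqrt ((1 - F a) / (a - 1)\<^sup>2) / q"
  by (auto simp: H_def V_def sgn_if real_sqrt_divide abs_if divide_simps)

text \<open>This explains the value \<open>1 / sqrt (p * q)\<close> in the definition of \<open>H\<close>: it is \<open>sqrt (q / p) / q\<close>.\<close>

lemma isCont_H_1: "isCont H 1"
proof -
  have "(\<lambda>a. sqrt ((1 - F a) / (a - 1)\<^sup>2) / q) \<midarrow>1\<rightarrow> sqrt (q / p) / q"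
    by (intro tendsto_intros H_sq_tendsto) auto
  moreover have "sqrt (q / p) / q = H 1"
    by (simp add: abs_of_pos H_simps real_sqrt_divide real_sqrt_mult field_simps)
  moreover have "\<forall>\<^sub>F x in at 1. x \<in> {0<..<p} \<and> x \<noteq> (1::real)"
    using p_gt1 eventually_at_in_open[of "{0<..<p}" 1] by (auto elim: eventually_mono)
  then have "\<forall>\<^sub>F a in at 1. sqrt ((1 - F a) / (a - 1)\<^sup>2) / q = H a"
    by eventually_elim (simp add: H_altdef)
  ultimately show ?thesis unfolding isCont_def using Lim_transform_eventually by force
qed

lemma continuous_on_H: "continuous_on {0..p} H"
proof -
  have "continuous (at a within {0..p}) H" if a: "a \<in> {0..p}" for a
  proof (cases "a = 1")
    case True
    then show ?thesis using isCont_H_1 by (auto intro: continuous_at_imp_continuous_at_within)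
  next
    case False
    have "continuous_on ({0..p} - {1}) (\<lambda>a. sqrt ((1 - F a) / (a - 1)\<^sup>2) / q)"
      by (intro continuous_intros continuous_on_subset[OF continuous_on_F]) auto
    then have "continuous_on ({0..p} - {1}) H"
      by (rule continuous_on_eq) (auto simp: H_altdef)
    then have "continuous (at a within {0..p} - {1}) H"
      using False a by (auto simp: continuous_on_eq_continuous_within)
    moreover have "at a within ({0..p} - {1}) = at a within {0..p}"
      using False by (intro at_within_nhd[of a "-{1}"]) auto
    ultimately show ?thesis by (simp add: continuous_within)
  qed
  then show ?thesis by (simp add: continuous_on_eq_continuous_within)
qed

lemma continuous_on_V: "continuous_on {0..p} V"
  unfolding V_eq_H[abs_def] by (intro continuous_intros continuous_on_H)

text \<open>Away from one this is the chain rule. At one the square root is not differentiable, but there the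
difference quotient of \<open>V\<close> equals \<open>q * H\<close>, which is continuous.\<close>

lemma V_deriv:
  assumes "0 < a" "a < p"
  shows "(V has_real_derivative F a / (p * H a * (a * bet a))) (at a)"
proof (cases "a = 1")
  case True
  have "((\<lambda>x. (V x - V 1) / (x - 1)) \<longlongrightarrow> q * H 1) (at 1)"
  proof (rule Lim_transform_eventually)
    show "((\<lambda>x. q * H x) \<longlongrightarrow> q * H 1) (at 1)"
      using isCont_H_1 unfolding isCont_def by (intro tendsto_intros)
    show "\<forall>\<^sub>F x in at 1. q * H x = (V x - V 1) / (x - 1)"
      unfolding eventually_at_filter by (auto simp: H_def)
  qed
  then have "(V has_real_derivative q * H 1) (at 1)"
    by (simp add: has_field_derivative_iff)
  moreover have "q * H 1 = F 1 / (p * H 1 * (1 * bet 1))"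
    using pos(1,2) by (simp add: H_simps field_simps abs_of_pos)
  ultimately show ?thesis using True by simp
next
  case False
  have F1: "F a < 1" using F_lt_1[of a] assms False by auto
  have nz: "sqrt (1 - F a) \<noteq> 0" "a - 1 \<noteq> 0" "bet a \<noteq> 0" using F1 False bet_pos[OF assms(2)] by auto
  have s: "sgn (a - 1) * sgn (a - 1) = (1::real)" using False by (auto simp: sgn_if)
  have sg: "sgn (a - 1) \<noteq> (0::real)" using False by (auto simp: sgn_if)
  have "((\<lambda>x. sgn (a - 1) * sqrt (1 - F x)) has_real_derivative F a / (p * H a * (a * bet a))) (at a)"
  proof (rule DERIV_cong)
    have "0 < 1 - F a" using F1 by simp
    then show "((\<lambda>x. sgn (a - 1) * sqrt (1 - F x)) has_real_derivative
      sgn (a - 1) * (inverse (sqrt (1 - F a)) / 2 * (0 - F a * (2 * q * (1 - a) / (p * (a * bet a)))))) (at a)"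
      by (intro DERIV_cmult DERIV_chain2[OF DERIV_real_sqrt] DERIV_diff DERIV_const F_deriv assms)
    have H: "H a = sgn (a - 1) * sqrt (1 - F a) / (q * (a - 1))" using False by (simp add: H_def V_def)
    show "sgn (a - 1) * (inverse (sqrt (1 - F a)) / 2 * (0 - F a * (2 * q * (1 - a) / (p * (a * bet a))))) =
      F a / (p * H a * (a * bet a))"
      unfolding H using nz sg s assms by (simp add: divide_simps) (simp add: algebra_simps)
  qed
  then show ?thesis
  proof (rule has_field_derivative_transform_within_open)
    show "open (if a < 1 then {..<1::real} else {1<..})" by simp
    show "a \<in> (if a < 1 then {..<1::real} else {1<..})" using False by simp
  qed (use False in \<open>auto simp: V_def sgn_if split: if_splits\<close>)
qed

text \<open>The coordinate change \<open>V\<close> inverted, and the time density as a function of \<open>v = V a\<close>.\<close>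

definition A :: "real \<Rightarrow> real" where "A v = inv_into {0..p} V v"
definition h :: "real \<Rightarrow> real" where "h v = H (A v)"

lemma V_image: "V ` {0..p} = {-1..1}"
proof (rule antisym)
  show "V ` {0..p} \<subseteq> {-1..1}"
    using strict_mono_onD[OF V_strict_mono, of 0] strict_mono_onD[OF V_strict_mono, of _ p] pos(1)
    by (force simp: le_less)
  show "{-1..1} \<subseteq> V ` {0..p}"
  proof
    fix v :: real assume "v \<in> {-1..1}"
    then show "v \<in> V ` {0..p}"
      using IVT'[of V 0 v p] continuous_on_V pos(1) by (auto simp: image_iff)
  qed
qed

lemma A_V: "a \<in> {0..p} \<Longrightarrow> A (V a) = a"
  by (simp add: A_def strict_mono_on_imp_inj_on[OF V_strict_mono])

lemma A_range: "v \<in> {-1..1} \<Longrightarrow> A v \<in> {0..p}"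
  and V_A: "v \<in> {-1..1} \<Longrightarrow> V (A v) = v"
  unfolding A_def V_image[symmetric] by (rule inv_into_into, assumption) (rule f_inv_into_f, assumption)

lemma A_simps: "A 0 = 1" "A 1 = p" "A (-1) = 0"
  using A_V[of 1] A_V[of p] A_V[of 0] p_gt1 by auto

lemma h_simps: "h 0 = 1 / sqrt (p * q)" "h 1 = 1 / p" "h (-1) = 1 / q"
  by (simp_all add: h_def A_simps H_simps)

lemma continuous_on_A: "continuous_on {-1..1} A"
  using continuous_on_inv[OF continuous_on_V compact_Icc, of A] A_V by (simp add: V_image)

lemma continuous_on_h: "continuous_on {-1..1} h"
  unfolding h_def
  by (rule continuous_on_compose2[OF continuous_on_H continuous_on_A]) (use A_range in auto)

lemma h_pos: "v \<in> {-1..1} \<Longrightarrow> 0 < h v"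
  unfolding h_def by (intro H_pos A_range)

lemma A_interior: "v \<in> {-1<..<1} \<Longrightarrow> 0 < A v \<and> A v < p"
  using A_range[of v] V_A[of v] V_simps by (metis atLeastAtMost_iff greaterThanLessThan_iff less_irrefl order_le_less)

lemma F_A: "v \<in> {-1..1} \<Longrightarrow> F (A v) = 1 - v\<^sup>2"
  using V_sq[OF A_range, of v] V_A[of v] by simp

lemma A_h: "v \<in> {-1..1} \<Longrightarrow> q * (A v - 1) * h v = v"
  using V_eq_H[of "A v"] V_A[of v] by (simp add: h_def)

lemma bet_h:
  assumes "v \<in> {-1..1}"
  shows "bet (A v) * h v = h v - v / p"
proof -
  have "bet (A v) * h v = h v - q * (A v - 1) * h v / p"
    using p_gt1 by (simp add: bet_def q_def field_simps)
  then show ?thesis using A_h[OF assms] by simp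
qed

lemma A_deriv:
  assumes "v \<in> {-1<..<1}"
  shows "(A has_real_derivative p * h v * (A v * bet (A v)) / (1 - v\<^sup>2)) (at v)"
proof -
  have a: "0 < A v" "A v < p" using A_interior[OF assms] by auto
  have v: "v \<in> {-1..1}" using assms by auto
  have nz: "F (A v) \<noteq> 0" "h v \<noteq> 0" "bet (A v) \<noteq> 0"
    using F_pos[OF a] h_pos[OF v] bet_pos[OF a(2)] by auto
  have "(A has_real_derivative inverse (F (A v) / (p * H (A v) * (A v * bet (A v))))) (at v)"
  proof (rule DERIV_inverse_function[where g = A and a = "-1" and b = 1, OF V_deriv[OF a]])
    show "F (A v) / (p * H (A v) * (A v * bet (A v))) \<noteq> 0"
      using nz a by (simp add: h_def)
    show "isCont A v" using continuous_on_A v assms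
      by (metis continuous_on_interior interior_atLeastAtMost_real)
  qed (use assms V_A in auto)
  then show ?thesis by (simp add: h_def F_A[OF v])
qed

section \<open>Orbits of prescribed angular momentum\<close>

text \<open>The derivative of the polar angle of \<open>x\<close> with respect to \<open>\<phi>\<close>, divided by the angular momentum: the angular velocity
is \<open>s * bet a / F a\<close>, and \<open>bet a * h v = h v - v / p\<close>.\<close>

definition spin :: "real \<Rightarrow> real" where "spin v = (h v - v / p) / (1 - v\<^sup>2)"

lemma continuous_on_h_open: "continuous_on {-1<..<1} h"
  by (rule continuous_on_subset[OF continuous_on_h]) auto

lemma continuous_on_spin: "continuous_on {-1<..<1} spin"
  unfolding spin_def by (intro continuous_on_weighted continuous_intros continuous_on_h_open) auto

lemma spin_alt: "v \<in> {-1<..<1} \<Longrightarrow> spin v = bet (A v) * h v / (1 - v\<^sup>2)"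
  using bet_h[of v] by (simp add: spin_def)

lemma circle_int_h_pos:
  assumes r: "\<bar>r\<bar> < 1"
  shows "0 < circle_int h r"
proof -
  obtain v0 where v0: "v0 \<in> {-1..1}" "\<And>v. v \<in> {-1..1} \<Longrightarrow> h v0 \<le> h v"
    using continuous_attains_inf[OF compact_Icc _ continuous_on_h] by auto
  have "circle_int (\<lambda>_. h v0) r \<le> circle_int h r"
    by (rule circle_int_mono[OF _ continuous_on_h_open r]) (use v0(2) in auto)
  moreover have "circle_int (\<lambda>_. h v0) r = 2 * pi * h v0" by (simp add: circle_int_def)
  moreover have "0 < 2 * pi * h v0" using h_pos[OF v0(1)] by simp
  ultimately show ?thesis by linarith
qed

text \<open>The term with \<open>v / p\<close> is odd and integrates to zero.\<close>

lemma circle_int_spin: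
  assumes r: "\<bar>r\<bar> < 1"
  shows "sqrt (1 - r\<^sup>2) * circle_int spin r = turn h r"
proof -
  note w = continuous_on_weighted[OF continuous_on_h_open] continuous_on_weighted[OF continuous_on_id]
  have "circle_int spin r = circle_int (\<lambda>v. 1 * (h v / (1 - v\<^sup>2)) + (- 1 / p) * (v / (1 - v\<^sup>2))) r"
    unfolding spin_def by (simp add: diff_divide_distrib)
  also have "\<dots> = 1 * circle_int (\<lambda>v. h v / (1 - v\<^sup>2)) r + (- 1 / p) * circle_int (\<lambda>v. v / (1 - v\<^sup>2)) r"
    by (rule circle_int_lincomb[OF w r])
  also have "circle_int (\<lambda>v. v / (1 - v\<^sup>2)) r = 0"
  proof -
    have "circle_int (\<lambda>v. v / (1 - v\<^sup>2)) r = circle_int (\<lambda>v. - v / (1 - v\<^sup>2)) r"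
      using circle_int_reflect[OF w(2) r] by simp
    also have "\<dots> = - circle_int (\<lambda>v. v / (1 - v\<^sup>2)) r"
      by (simp add: circle_int_def)
    finally show ?thesis by simp
  qed
  finally show ?thesis by (simp add: turn_def)
qed

text \<open>The orbit as a curve in the parameter \<open>\<phi>\<close>, in complex notation. Since \<open>x \<bullet> y\<close> and \<open>x \<times> y\<close> are the real and
imaginary parts of \<open>cnj x * y\<close>, they determine \<open>y = (r cos \<phi> + \<i> s) / |x| * cis \<theta>\<close>. The factor \<open>h\<close> in the
derivatives is \<open>dt/d\<phi>\<close>.\<close>

lemma orbit_in_angle:
  assumes r: "\<bar>r\<bar> < 1" and \<theta>: "\<And>\<phi>. (\<theta> has_real_derivative sqrt (1 - r\<^sup>2) * spin (r * sin \<phi>)) (at \<phi>)"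
    and X_def: "X = (\<lambda>\<phi>. of_real (A (r * sin \<phi>) powr (1 / p)) * cis (\<theta> \<phi>))"
    and Y_def: "Y = (\<lambda>\<phi>. Complex (r * cos \<phi>) (sqrt (1 - r\<^sup>2)) * of_real (1 / A (r * sin \<phi>) powr (1 / p)) * cis (\<theta> \<phi>))"
  shows "X \<phi> \<noteq> 0" "Y \<phi> \<noteq> 0"
    and "(X has_vector_derivative (h (r * sin \<phi>) * norm (Y \<phi>) powr (q - 2)) *\<^sub>R Y \<phi>) (at \<phi>)"
    and "(Y has_vector_derivative (- (h (r * sin \<phi>) * norm (X \<phi>) powr (p - 2))) *\<^sub>R X \<phi>) (at \<phi>)"
proof -
  define v where "v = r * sin \<phi>"
  define W where "W = r * cos \<phi>"
  define s where "s = sqrt (1 - r\<^sup>2)"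
  define a where "a = A v"
  define b where "b = bet a"
  define \<rho> where "\<rho> = a powr (1 / p)"
  define e where "e = cis (\<theta> \<phi>)"
  have v: "v \<in> {-1<..<1}" unfolding v_def by (rule sin_circle_in[OF r])
  have v': "v \<in> {-1..1}" using v by auto
  have a: "0 < a" "a < p" using A_interior[OF v] by (auto simp: a_def)
  have b: "0 < b" unfolding b_def by (rule bet_pos[OF a(2)])
  have \<rho>: "0 < \<rho>" using a by (simp add: \<rho>_def)
  have hv: "0 < h v" by (rule h_pos[OF v'])
  have s0: "0 < s" using sq_less_1[OF r] by (simp add: s_def)
  have v2: "v\<^sup>2 < 1" using v by (intro sq_less_1) auto
  have WS: "W * W + s * s = 1 - v\<^sup>2"
    using sq_less_1[OF r] by (simp add: W_def s_def v_def power_mult_distrib cos_squared_eq right_diff_distrib flip: power2_eq_square)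
  have F: "1 - v\<^sup>2 = (\<rho> * b powr (1 / q))\<^sup>2"
    using F_A[OF v'] a b
    by (simp add: F_def a_def[symmetric] b_def[symmetric] \<rho>_def power_mult_distrib powr_power)
  have spin: "spin v = b * h v / (1 - v\<^sup>2)"
    using spin_alt[OF v] by (simp add: a_def b_def)
  have \<rho>p: "\<rho> powr p = a" using a by (simp add: \<rho>_def powr_powr)
  have X: "X \<phi> = of_real \<rho> * e" and Y: "Y \<phi> = Complex W s * of_real (1 / \<rho>) * e"
    by (simp_all add: X_def Y_def \<rho>_def a_def v_def W_def s_def e_def)
  show "X \<phi> \<noteq> 0" using \<rho> by (simp add: X e_def)
  have "Complex W s \<noteq> 0" using s0 by (simp add: complex_eq_iff)
  then show "Y \<phi> \<noteq> 0" using \<rho> by (simp add: Y e_def)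
  have nX: "norm (X \<phi>) = \<rho>" using \<rho> by (simp add: X e_def norm_mult)
  have nY: "norm (Y \<phi>) = b powr (1 / q)"
  proof -
    have "norm (Complex W s) = sqrt (1 - v\<^sup>2)"
      using WS by (simp add: cmod_def power2_eq_square)
    also have "\<dots> = \<rho> * b powr (1 / q)" using F \<rho> by simp
    finally show ?thesis using \<rho> by (simp add: Y e_def norm_mult norm_divide)
  qed
  have \<rho>D: "((\<lambda>\<phi>. A (r * sin \<phi>) powr (1 / p)) has_real_derivative \<rho> * spin v * W) (at \<phi>)"
  proof -
    have "((\<lambda>\<phi>. A (r * sin \<phi>)) has_real_derivative p * h v * (a * b) / (1 - v\<^sup>2) * W) (at \<phi>)"
    proof -
      have "((\<lambda>\<phi>. r * sin \<phi>) has_real_derivative W) (at \<phi>)"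
        by (auto intro!: derivative_eq_intros simp: W_def)
      from DERIV_chain2[where f = A and g = "\<lambda>\<phi>. r * sin \<phi>", OF A_deriv[OF v, unfolded v_def] this]
      show ?thesis by (simp only: v_def a_def b_def)
    qed
    from DERIV_powr[OF this _ DERIV_const[of "1 / p"]] a show ?thesis
      by (simp add: spin \<rho>_def flip: v_def a_def) (simp add: mult_ac)
  qed
  have \<sigma>D: "((\<lambda>\<phi>. 1 / A (r * sin \<phi>) powr (1 / p)) has_real_derivative - (spin v * W / \<rho>)) (at \<phi>)"
  proof -
    have \<rho>': "A (r * sin \<phi>) powr (1 / p) = \<rho>" by (simp add: \<rho>_def a_def v_def)
    show ?thesis
      using DERIV_divide[OF DERIV_const[of 1] \<rho>D] \<rho> unfolding \<rho>' by (simp add: field_simps)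
  qed
  have eD: "((\<lambda>\<phi>. cis (\<theta> \<phi>)) has_vector_derivative \<i> * of_real (s * spin v) * e) (at \<phi>)"
    unfolding e_def s_def v_def by (rule has_vector_derivative_cis[OF \<theta>])
  have WD: "((\<lambda>\<phi>. Complex (r * cos \<phi>) (sqrt (1 - r\<^sup>2))) has_vector_derivative of_real (- v)) (at \<phi>)"
  proof -
    have "((\<lambda>\<phi>. r * cos \<phi>) has_real_derivative - v) (at \<phi>)"
      by (auto intro!: derivative_eq_intros simp: v_def)
    from has_vector_derivative_add[OF has_vector_derivative_of_real[OF this]
      has_vector_derivative_const[of "\<i> * of_real s"]]
    show ?thesis by (simp add: Complex_eq s_def)
  qed
  have C: "Complex W s = of_real W + \<i> * of_real s" by (simp add: Complex_eq)
  \<comment> \<open>This is the equation for \<open>x'\<close>, freed of the common factors.\<close>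
  have key1: "\<rho> * spin v = h v * norm (Y \<phi>) powr (q - 2) / \<rho>"
  proof -
    have "norm (Y \<phi>) powr (q - 2) = b powr (1 - 2 / q)"
      by (simp add: nY powr_powr diff_divide_distrib)
    also have "\<dots> = b / b powr (2 / q)" using b by (simp add: powr_diff)
    also have "b powr (2 / q) = (b powr (1 / q))\<^sup>2" using b by (simp add: powr_power)
    finally have "norm (Y \<phi>) powr (q - 2) = b / (b powr (1 / q))\<^sup>2" .
    then show ?thesis using \<rho> b unfolding spin F by (simp add: field_simps power2_eq_square)
  qed
  \<comment> \<open>This is the equation for \<open>y'\<close>; the product \<open>(W + \<i> s) (- W + \<i> s) = - (W\<^sup>2 + s\<^sup>2)\<close> brings in \<open>1 - v\<^sup>2\<close>.\<close>
  have key2: "(v + spin v * (W * W + s * s)) / \<rho> = h v * norm (X \<phi>) powr (p - 2) * \<rho>"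
  proof -
    have "spin v * (W * W + s * s) = b * h v" using v2 by (simp add: WS spin)
    moreover have "v = q * (a - 1) * h v" using A_h[OF v'] by (simp add: a_def)
    ultimately have "v + spin v * (W * W + s * s) = (q * (a - 1) + b) * h v"
      by (simp add: algebra_simps)
    also have "q * (a - 1) + b = a" using bet_minus[of a] by (simp add: b_def algebra_simps)
    also have "a = \<rho> powr (p - 2) * (\<rho> * \<rho>)"
      using \<rho> \<rho>p by (simp add: powr_diff power2_eq_square)
    finally show ?thesis using \<rho> by (simp add: nX)
  qed
  show "(X has_vector_derivative (h (r * sin \<phi>) * norm (Y \<phi>) powr (q - 2)) *\<^sub>R Y \<phi>) (at \<phi>)"
  proof -
    have "(X has_vector_derivative of_real \<rho> * (\<i> * of_real (s * spin v) * e) + of_real (\<rho> * spin v * W) * e) (at \<phi>)"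
      using has_vector_derivative_mult[OF has_vector_derivative_of_real[OF \<rho>D] eD]
      by (simp add: X_def \<rho>_def a_def v_def e_def)
    also have "of_real \<rho> * (\<i> * of_real (s * spin v) * e) + of_real (\<rho> * spin v * W) * e
        = of_real (\<rho> * spin v) * Complex W s * e"
      by (simp add: C algebra_simps)
    also have "\<dots> = (h v * norm (Y \<phi>) powr (q - 2)) *\<^sub>R Y \<phi>"
      unfolding key1 by (simp add: Y scaleR_conv_of_real)
    finally show ?thesis by (simp add: v_def)
  qed
  show "(Y has_vector_derivative (- (h (r * sin \<phi>) * norm (X \<phi>) powr (p - 2))) *\<^sub>R X \<phi>) (at \<phi>)"
  proof -
    have "(Y has_vector_derivative
        Complex W s * of_real (1 / \<rho>) * (\<i> * of_real (s * spin v) * e)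
        + (Complex W s * of_real (- (spin v * W / \<rho>)) + of_real (- v) * of_real (1 / \<rho>)) * e) (at \<phi>)"
      using has_vector_derivative_mult[OF has_vector_derivative_mult[OF WD
        has_vector_derivative_of_real[OF \<sigma>D]] eD]
      by (simp only: Y_def \<rho>_def a_def v_def e_def W_def s_def)
    also have "Complex W s * of_real (1 / \<rho>) * (\<i> * of_real (s * spin v) * e)
        + (Complex W s * of_real (- (spin v * W / \<rho>)) + of_real (- v) * of_real (1 / \<rho>)) * e
        = of_real (- ((v + spin v * (W * W + s * s)) / \<rho>)) * e"
      using \<rho> by (simp add: C divide_simps) (simp add: algebra_simps)
    also have "\<dots> = (- (h v * norm (X \<phi>) powr (p - 2))) *\<^sub>R X \<phi>"
      unfolding key2 by (simp add: X scaleR_conv_of_real)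
    finally show ?thesis by (simp add: v_def)
  qed
qed

text \<open>Time \<open>\<tau>\<close> and polar angle \<open>\<theta>\<close> are antiderivatives of \<open>h\<close> and of \<open>s * spin\<close> along the circle. Inverting
\<open>\<tau>\<close> turns the curve of the preceding lemma into a solution. After \<open>l\<close> turns of the circle the solution has
been rotated by \<open>l * turn h r\<close>, so that it is closed if this is a multiple of \<open>2 \<pi>\<close>.\<close>

lemma orbit_exists:
  assumes r: "\<bar>r\<bar> < 1"
  shows "\<exists>x y :: real \<Rightarrow> complex.
    (\<forall>t. x t \<noteq> 0 \<and> y t \<noteq> 0
      \<and> (x has_vector_derivative norm (y t) powr (q - 2) *\<^sub>R y t) (at t)
      \<and> (y has_vector_derivative - (norm (x t) powr (p - 2) *\<^sub>R x t)) (at t)) \<and>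
    (\<forall>l k. real l * turn h r = 2 * pi * real k \<longrightarrow>
      x (real l * circle_int h r) = x 0 \<and> y (real l * circle_int h r) = y 0)"
proof -
  have range: "r * sin \<phi> \<in> {-1..1}" for \<phi> using sin_circle_in[OF r, of \<phi>] by auto
  obtain \<tau> where \<tau>: "\<tau> 0 = 0" "\<And>\<phi>. (\<tau> has_real_derivative h (r * sin \<phi>)) (at \<phi>)"
    "\<And>n. \<tau> (2 * pi * real n) = real n * circle_int h r"
    using periodic_antiderivative[OF continuous_on_sin_circle[OF continuous_on_h_open r], of "2 * pi"]
    unfolding circle_int_def by auto
  obtain \<theta> where \<theta>: "\<theta> 0 = 0" "\<And>\<phi>. (\<theta> has_real_derivative sqrt (1 - r\<^sup>2) * spin (r * sin \<phi>)) (at \<phi>)"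
    "\<And>n. \<theta> (2 * pi * real n) = real n * integral {0..2*pi} (\<lambda>\<phi>. sqrt (1 - r\<^sup>2) * spin (r * sin \<phi>))"
    using periodic_antiderivative[where c = "2 * pi", OF continuous_on_mult_left[where c = "sqrt (1 - r\<^sup>2)",
        OF continuous_on_sin_circle[OF continuous_on_spin r]]] by auto
  have \<theta>n: "\<theta> (2 * pi * real n) = real n * turn h r" for n
    by (simp add: \<theta>(3) circle_int_spin[OF r, symmetric] circle_int_def)
  obtain v0 where v0: "v0 \<in> {-1..1}" "\<And>v. v \<in> {-1..1} \<Longrightarrow> h v0 \<le> h v"
    using continuous_attains_inf[OF compact_Icc _ continuous_on_h] by auto
  obtain \<Phi> where \<Phi>: "\<And>x. \<Phi> (\<tau> x) = x" "\<And>t. (\<Phi> has_real_derivative 1 / h (r * sin (\<Phi> t))) (at t)"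
    using increasing_antiderivative_inverse[OF \<tau>(2,1) h_pos[OF v0(1)] v0(2)[OF range]] by blast
  have \<Phi>n: "\<Phi> (real n * circle_int h r) = 2 * pi * real n" for n
    using \<Phi>(1)[of "2 * pi * real n"] by (simp add: \<tau>(3))
  have \<Phi>0: "\<Phi> 0 = 0" using \<Phi>n[of 0] by simp
  define X where "X = (\<lambda>\<phi>. of_real (A (r * sin \<phi>) powr (1 / p)) * cis (\<theta> \<phi>))"
  define Y where "Y = (\<lambda>\<phi>. Complex (r * cos \<phi>) (sqrt (1 - r\<^sup>2)) * of_real (1 / A (r * sin \<phi>) powr (1 / p)) * cis (\<theta> \<phi>))"
  note orb = orbit_in_angle[OF r \<theta>(2) X_def Y_def]
  have per: "X (2 * pi * real l) = X 0 \<and> Y (2 * pi * real l) = Y 0"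
    if lk: "real l * turn h r = 2 * pi * real k" for l k
  proof -
    have "sin (2 * pi * real l) = 0" "cos (2 * pi * real l) = 1"
      using sin_2npi[of l] cos_2npi[of l] by (simp_all add: mult_ac)
    moreover have "cis (\<theta> (2 * pi * real l)) = 1"
      unfolding \<theta>n lk using cis_multiple_2pi[of "real k"] by simp
    ultimately show ?thesis by (simp add: X_def Y_def \<theta>(1))
  qed
  show ?thesis
  proof (rule exI[of _ "\<lambda>t. X (\<Phi> t)"], rule exI[of _ "\<lambda>t. Y (\<Phi> t)"], intro conjI allI impI)
    fix t
    have hpos: "h (r * sin (\<Phi> t)) \<noteq> 0" using h_pos[OF range[of "\<Phi> t"]] by simp
    note \<Phi>D = \<Phi>(2)[unfolded has_real_derivative_iff_has_vector_derivative, of t]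
    show "X (\<Phi> t) \<noteq> 0" by (rule orb(1))
    show "Y (\<Phi> t) \<noteq> 0" by (rule orb(2))
    show "((\<lambda>t. X (\<Phi> t)) has_vector_derivative norm (Y (\<Phi> t)) powr (q - 2) *\<^sub>R Y (\<Phi> t)) (at t)"
      using vector_diff_chain_at[OF \<Phi>D orb(3)] hpos by (simp add: o_def)
    show "((\<lambda>t. Y (\<Phi> t)) has_vector_derivative - (norm (X (\<Phi> t)) powr (p - 2) *\<^sub>R X (\<Phi> t))) (at t)"
      using vector_diff_chain_at[OF \<Phi>D orb(4)] hpos by (simp add: o_def)
  qed (use per in \<open>auto simp: \<Phi>n \<Phi>0\<close>)
qed

end

section \<open>From closed orbits to eigenvalues\<close>

definition to_plane :: "complex \<Rightarrow> real ^ 2" where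
  "to_plane z = Re z *\<^sub>R axis 1 1 + Im z *\<^sub>R axis 2 1"

lemma bounded_linear_to_plane: "bounded_linear to_plane"
  unfolding to_plane_def
  by (intro bounded_linear_add bounded_linear_scaleR_left[THEN bounded_linear_compose] bounded_linear_Re bounded_linear_Im)

lemma norm_to_plane: "norm (to_plane z) = norm z"
  by (simp add: to_plane_def norm_vec_def L2_set_def UNIV_2 axis_def cmod_def)

context conjugate_exponents begin

text \<open>Rescaling time by \<open>P\<close> multiplies \<open>phi p x'\<close> by \<open>P powr (p - 1)\<close> and its derivative by \<open>P powr p\<close>. The equation
for \<open>x\<close> makes \<open>y\<close> equal to \<open>phi p x'\<close> because \<open>(q - 1) * (p - 1) = 1\<close>. As \<open>x\<close> and \<open>y\<close> do not vanish, all
functions involved are continuously differentiable.\<close>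

lemma eigenvalue_of_period:
  fixes x y :: "real \<Rightarrow> complex"
  assumes nz: "\<And>t. x t \<noteq> 0" "\<And>t. y t \<noteq> 0"
    and xD: "\<And>t. (x has_vector_derivative norm (y t) powr (q - 2) *\<^sub>R y t) (at t)"
    and yD: "\<And>t. (y has_vector_derivative - (norm (x t) powr (p - 2) *\<^sub>R x t)) (at t)"
    and P: "0 < P" "x P = x 0" "y P = y 0"
  shows "P powr p \<in> Sigma_star p"
proof -
  interpret bounded_linear to_plane by (rule bounded_linear_to_plane)
  define u where "u = (\<lambda>t. to_plane (x (P * t)))"
  define u' where "u' = (\<lambda>t. (P * norm (y (P * t)) powr (q - 2)) *\<^sub>R to_plane (y (P * t)))"
  have scale: "((\<lambda>t. to_plane (f (P * t))) has_vector_derivative P *\<^sub>R to_plane D) (at t)"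
    if "(f has_vector_derivative D) (at (P * t))" for f D t
  proof -
    have "((\<lambda>t. P * t) has_vector_derivative P) (at t)"
      by (auto intro!: derivative_eq_intros simp flip: has_real_derivative_iff_has_vector_derivative)
    from has_vector_derivative[OF vector_diff_chain_at[OF this that]] show ?thesis
      by (simp add: o_def scaleR)
  qed
  have uD: "(u has_vector_derivative u' t) (at t)" for t
    using scale[OF xD] by (simp add: u_def u'_def scaleR)
  have u'_eq: "vector_derivative u (at t) = u' t" for t
    by (rule vector_derivative_at[OF uD])
  have phi_u': "phi p (u' t) = P powr (p - 1) *\<^sub>R to_plane (y (P * t))" for t
  proof -
    define n where "n = norm (y (P * t))"
    have n: "0 < n" using nz by (simp add: n_def)
    have "norm (u' t) = P * (n powr (q - 2) * n)"
      using P(1) by (simp add: u'_def norm_to_plane n_def)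
    also have "n powr (q - 2) * n = n powr (q - 1)"
      using n powr_add[of n "q - 2" 1] by simp
    finally have "norm (u' t) powr (p - 2) * (P * n powr (q - 2))
        = (P powr (p - 2) * P) * (n powr ((q - 1) * (p - 2)) * n powr (q - 2))"
      using P(1) n by (simp add: powr_mult powr_powr)
    also have "P powr (p - 2) * P = P powr (p - 1)"
      using P(1) powr_add[of P "p - 2" 1] by simp
    also have "n powr ((q - 1) * (p - 2)) * n powr (q - 2) = n powr ((q - 1) * (p - 2) + (q - 2))"
      by (simp add: powr_add)
    also have "(q - 1) * (p - 2) + (q - 2) = 0" using q_times by (simp add: algebra_simps)
    finally show ?thesis using n by (simp add: phi_def u'_def n_def)
  qed
  have wD: "((\<lambda>t. phi p (u' t)) has_vector_derivative - (P powr p *\<^sub>R phi p (u t))) (at t)" for t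
  proof -
    have "((\<lambda>t. P powr (p - 1) *\<^sub>R to_plane (y (P * t))) has_vector_derivative
        P powr (p - 1) *\<^sub>R P *\<^sub>R to_plane (- (norm (x (P * t)) powr (p - 2) *\<^sub>R x (P * t)))) (at t)"
      using bounded_linear.has_vector_derivative[OF bounded_linear_scaleR_right scale[OF yD]] .
    moreover have "P powr (p - 1) * (P * c) = P powr p * c" for c
      using P(1) powr_add[of P "p - 1" 1] by simp
    ultimately show ?thesis
      unfolding phi_u' by (simp add: phi_def u_def norm_to_plane scaleR neg)
  qed
  have cont: "continuous_on UNIV (\<lambda>t. f (P * t))" if "\<And>t. (f has_vector_derivative D t) (at t)"
    for f :: "real \<Rightarrow> complex" and D
  proof -
    have "continuous_on UNIV f"
      using that by (auto intro!: continuous_at_imp_continuous_on has_vector_derivative_continuous)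
    then show ?thesis by (rule continuous_on_compose2) (auto intro!: continuous_intros)
  qed
  have ux: "continuous_on UNIV u" unfolding u_def by (intro continuous_on cont[OF xD])
  have "continuous_on UNIV u'" unfolding u'_def
    by (intro continuous_intros continuous_on cont[OF yD]) (use nz in auto)
  then have C1: "u C1_differentiable_on UNIV"
    unfolding C1_differentiable_on_def using uD by blast
  have "continuous_on UNIV (\<lambda>t. - (P powr p *\<^sub>R phi p (u t)))" unfolding phi_def
    by (intro continuous_intros ux) (use nz norm_to_plane in \<open>auto simp: u_def\<close>)
  then have C1': "(\<lambda>t. phi p (u' t)) C1_differentiable_on UNIV"
    unfolding C1_differentiable_on_def using wD
    by (intro exI[of _ "\<lambda>t. - (P powr p *\<^sub>R phi p (u t))"]) auto
  have "p_laplacian_solution p (P powr p) u"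
    unfolding p_laplacian_solution_def u'_eq using C1 C1' vector_derivative_at[OF wD] by simp
  moreover have "u 0 \<noteq> 0" using nz norm_to_plane[of "x 0"] by (auto simp: u_def)
  moreover have "u 1 = u 0" "u' 1 = u' 0" using P by (simp_all add: u_def u'_def)
  ultimately have "periodic_eigenvalue p (P powr p)"
    unfolding periodic_eigenvalue_def u'_eq[abs_def] by (metis u'_eq)
  then show ?thesis using P(1) by (simp add: Sigma_star_def)
qed

lemma resonant_period_eigenvalue:
  assumes r: "\<bar>r\<bar> < 1" and l: "0 < l" and res: "real l * turn h r = 2 * pi * real k" and n: "1 \<le> n"
  shows "(real n * (real l * circle_int h r)) powr p \<in> Sigma_star p"
proof -
  have "real (n * l) * turn h r = 2 * pi * real (n * k)" using res by simp
  then obtain x y :: "real \<Rightarrow> complex" where xy: "\<And>t. x t \<noteq> 0" "\<And>t. y t \<noteq> 0"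
      "\<And>t. (x has_vector_derivative norm (y t) powr (q - 2) *\<^sub>R y t) (at t)"
      "\<And>t. (y has_vector_derivative - (norm (x t) powr (p - 2) *\<^sub>R x t)) (at t)"
      "x (real (n * l) * circle_int h r) = x 0" "y (real (n * l) * circle_int h r) = y 0"
    using orbit_exists[OF r] by metis
  have "0 < real (n * l) * circle_int h r"
    using circle_int_h_pos[OF r] n l by simp
  from eigenvalue_of_period[OF xy(1-4) this xy(5,6)] show ?thesis
    by (simp add: mult.assoc)
qed

text \<open>The turning angles \<open>2 \<pi> c m\<close> are prescribed as rational multiples of \<open>2 \<pi>\<close> that increase to \<open>2 \<pi> x\<close>, with
denominators \<open>N m\<close> in arithmetic progression. At their last crossings before \<open>R\<close> the periods of the radial
oscillation increase, and multiplication by \<open>N m\<close> makes the increase strict and linearly bounded.\<close>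

lemma resonant_sequence:
  assumes "p \<noteq> 2"
  shows "\<exists>t :: nat \<Rightarrow> real. \<exists>C. strict_mono t \<and> (\<forall>m. 0 < t m) \<and> (\<forall>m. t m \<le> C * real (Suc m)) \<and>
    filterlim t at_top sequentially \<and> (\<forall>m n. 1 \<le> n \<longrightarrow> (real n * t m) powr p \<in> Sigma_star p)"
proof -
  have pq4: "4 < p * q"
  proof -
    have "0 < (p - 2)\<^sup>2" using assms by simp
    then have "4 * (p - 1) < p * p" by (simp add: power2_eq_square algebra_simps)
    then show ?thesis using p_gt1 by (simp add: q_def field_simps)
  qed
  have "2 < sqrt (p * q)" using pq4 real_sqrt_less_mono[of 4 "p * q"] by simp
  then have "2 * h 0 < h 1 + h (-1)"
    using inverse_exponents_sum by (simp add: h_simps)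
  from exists_turn_gt[OF continuous_on_h _ this]
  obtain R where R: "0 < R" "R < 1" "turn h 0 < turn h R" using h_pos less_imp_le by blast
  have "turn h 0 / (2 * pi) < turn h R / (2 * pi)" using R(3) by (simp add: divide_strict_right_mono)
  then obtain x where x: "x \<in> \<rat>" "turn h 0 / (2 * pi) < x" "x < turn h R / (2 * pi)"
    using Rats_dense_in_real by blast
  have "0 \<le> turn h 0" using circle_int_h_pos[of 0] by (simp add: turn_def circle_int_def)
  then have x0: "0 < x" using x(2) by (smt (verit) divide_nonneg_pos pi_gt_zero)
  then obtain k l :: nat where kl: "l \<noteq> 0" "x = real k / real l"
    using Rats_abs_nat_div_natE[OF x(1)] abs_of_pos[OF x0] by metis
  have k0: "0 < k" using x0 kl by (auto intro: gr0I)
  \<comment> \<open>The shift by \<open>M\<close> keeps \<open>c m\<close>, which is \<open>x - 1 / N m\<close>, above \<open>turn h 0 / (2 * pi)\<close>.\<close>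
  obtain M :: nat where M: "1 / (x - turn h 0 / (2 * pi)) < real M" using reals_Archimedean2 by blast
  define N where "N = (\<lambda>m. l * (m + Suc M))"
  have N_pos: "0 < N m" for m using kl(1) by (simp add: N_def)
  have N_mono: "N m < N m'" if "m < m'" for m m' using that kl(1) by (simp add: N_def)
  have N_ge: "m \<le> N m" "M \<le> N m" for m using kl(1) by (cases l; simp add: N_def)+
  have N_le: "N m \<le> l * Suc M * Suc m" for m
    unfolding N_def mult.assoc by (rule mult_le_mono2) simp
  define j where "j = (\<lambda>m. k * (m + Suc M) - 1)"
  define c where "c = (\<lambda>m. real (j m) / real (N m))"
  have c: "c m = x - 1 / real (N m)" for m
  proof -
    have "1 \<le> k * (m + Suc M)" using k0 by simp
    then have "real (j m) = real k * real (m + Suc M) - 1"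
      unfolding j_def by (simp only: of_nat_diff of_nat_mult of_nat_1)
    moreover have "real k * real (m + Suc M) = x * real (N m)"
      unfolding N_def kl(2) of_nat_mult using kl(1) by simp
    ultimately show ?thesis using N_pos[of m] by (simp add: c_def field_simps)
  qed
  have c_mono: "c m < c m'" if "m < m'" for m m'
    unfolding c using N_mono[OF that] N_pos[of m] by (simp add: divide_strict_left_mono)
  have c_bounds: "turn h 0 \<le> 2 * pi * c m \<and> 2 * pi * c m \<le> turn h R" for m
  proof -
    define d where "d = x - turn h 0 / (2 * pi)"
    have d: "0 < d" using x(2) by (simp add: d_def)
    have "1 / d < real (N m)" using M N_ge(2)[of m] by (simp add: d_def)
    then have "1 / real (N m) \<le> d" using d N_pos[of m] by (simp add: field_simps)
    then have "turn h 0 / (2 * pi) \<le> c m" by (simp add: c d_def)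
    moreover have "c m \<le> x" by (simp add: c)
    ultimately have "turn h 0 / (2 * pi) \<le> c m" "c m \<le> turn h R / (2 * pi)" using x(3) by auto
    then show ?thesis by (simp add: field_simps)
  qed
  have "\<exists>r\<in>{0..R}. turn h r = 2 * pi * c m \<and> (\<forall>\<rho>\<in>{r..R}. 2 * pi * c m \<le> turn h \<rho>)" for m
    using R c_bounds[of m]
    by (intro last_crossing continuous_on_subset[OF continuous_on_turn[OF continuous_on_h_open]]) auto
  then obtain r where r: "\<And>m. r m \<in> {0..R}" "\<And>m. turn h (r m) = 2 * pi * c m"
    "\<And>m \<rho>. \<rho> \<in> {r m..R} \<Longrightarrow> 2 * pi * c m \<le> turn h \<rho>"
    by metis
  define T where "T = (\<lambda>m. circle_int h (r m))"
  have r1: "\<bar>r m\<bar> < 1" for m using r(1)[of m] R by auto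
  have T_pos: "0 < T m" for m unfolding T_def by (rule circle_int_h_pos[OF r1])
  have r_mono: "r m < r m'" if "m < m'" for m m'
  proof (rule ccontr)
    assume "\<not> r m < r m'"
    then have "2 * pi * c m' \<le> turn h (r m)" using r(1)[of m] by (intro r(3)) auto
    then show False using r(2)[of m] c_mono[OF that] by simp
  qed
  have T_mono: "T m \<le> T m'" if "m \<le> m'" for m m'
  proof (cases "m = m'")
    case False
    then have "r m < r m'" using that by (intro r_mono) auto
    then show ?thesis unfolding T_def using r(1)[of m] r(1)[of m'] R r(3)[of _ m]
      by (intro circle_int_le_of_turn_ge continuous_on_h_open) (auto simp: r(2))
  qed simp
  define t where "t = (\<lambda>m. real (N m) * T m)"
  obtain B where B: "\<And>m. T m \<le> B"
  proof -
    have "continuous_on {0..R} (circle_int h)"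
      by (rule continuous_on_subset[OF continuous_on_circle_int[OF continuous_on_h_open]]) (use R in auto)
    then obtain z where "\<And>\<rho>. \<rho> \<in> {0..R} \<Longrightarrow> circle_int h \<rho> \<le> circle_int h z"
      using continuous_attains_sup[OF compact_Icc, of 0 R] R(1) by (auto simp: Ball_def)
    then have "T m \<le> circle_int h z" for m unfolding T_def using r(1) by blast
    then show ?thesis by (rule that)
  qed
  have lower: "T 0 * real m \<le> t m" for m
  proof -
    have "T 0 * real m \<le> T m * real (N m)"
      using T_mono[of 0 m] T_pos[of m] N_ge(1)[of m] by (intro mult_mono) auto
    then show ?thesis by (simp add: t_def mult.commute)
  qed
  show ?thesis
  proof (intro exI conjI allI impI)
    show "strict_mono t"
    proof (rule strict_monoI)
      fix m m' :: nat assume lt: "m < m'"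
      then show "t m < t m'"
        unfolding t_def using T_mono[of m m'] T_pos[of m] N_mono[OF lt]
        by (intro mult_less_le_imp_less) auto
    qed
    show "0 < t m" for m
      using T_pos[of m] N_pos[of m] by (simp add: t_def)
    show "t m \<le> (real (l * Suc M) * B) * real (Suc m)" for m
    proof -
      have "real (N m) * T m \<le> real (l * Suc M * Suc m) * B"
        using N_le T_pos[of m] B[of m] by (intro mult_mono of_nat_mono) (assumption | simp)+
      also have "\<dots> = (real (l * Suc M) * B) * real (Suc m)"
        by (simp only: of_nat_mult mult_ac)
      finally show ?thesis by (simp only: t_def)
    qed
    show "filterlim t at_top sequentially"
    proof (rule filterlim_at_top_mono)
      show "filterlim (\<lambda>m. T 0 * real m) at_top sequentially"
        using T_pos[of 0] by (intro filterlim_tendsto_pos_mult_at_top[OF tendsto_const] filterlim_real_sequentially)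
    qed (use lower in simp)
    show "(real n * t m) powr p \<in> Sigma_star p" if "1 \<le> n" for m n
    proof -
      have "real (N m) * turn h (r m) = 2 * pi * real (j m)"
        using N_pos[of m] by (simp add: r(2) c_def)
      from resonant_period_eigenvalue[OF r1 N_pos this that] show ?thesis
        by (simp add: t_def T_def)
    qed
  qed
qed

end

theorem theorem1p1:
  fixes p :: real
  assumes "1 < p" and "p \<noteq> 2"
  shows "\<exists>w :: nat \<Rightarrow> real.
    (\<forall>m\<ge>1. 0 < w m) \<and>
    (\<forall>m\<ge>1. \<forall>m'\<ge>1. m \<noteq> m' \<longrightarrow> w m / w m' \<notin> {real k | k. 1 \<le> k}) \<and>
    (\<forall>m\<ge>1. {(2 * real n * w m) powr p | n. 1 \<le> n} \<subseteq> Sigma_star p)"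
proof -
  interpret conjugate_exponents p "p / (p - 1)"
    using assms by unfold_locales auto
  obtain t :: "nat \<Rightarrow> real" and C where t: "strict_mono t" "\<And>m. 0 < t m" "\<And>m. t m \<le> C * real (Suc m)"
    "filterlim t at_top sequentially" "\<And>m n. 1 \<le> n \<Longrightarrow> (real n * t m) powr p \<in> Sigma_star p"
    using resonant_sequence[OF assms(2)] by metis
  obtain f :: "nat \<Rightarrow> nat" where f: "\<And>i j. i \<noteq> j \<Longrightarrow> t (f i) / t (f j) \<notin> {real k | k. 1 \<le> k}"
    using infinite_nondividing_subsequence[OF t(1-4)] by blast
  show ?thesis
    using f t(2,5) by (intro exI[of _ "\<lambda>m. t (f m) / 2"]) (auto simp: mult_ac)
qed

end
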